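(* Assume $$\varphi\in D(\mathcal L^s),\qquad f\in C([0,T];D(\mathcal L^s)),\qquad\omega\in L^2(0,l),\qquad w\in C^1[0,T],$$ the compatibility condition $w(0)=(\varphi,\omega)_{L^2}$, and the nondegeneracy condition $|(f(t),\omega)_{L^2}|\ge\kappa_0>0$ for $0\le t\le T$. For $r\in C[0,T]$ let $$u_r(t)=E_s(t)\varphi+\int_0^tE_s(t-\tau)r(\tau)f(\tau)\,d\tau,\qquad0\le t\le T,$$ be the mild solution of $u_t+\mathcal L^su=rf$, $u(0)=\varphi$. Set $$g(t)=\frac{w'(t)+(\mathcal L^sE_s(t)\varphi,\omega)_{L^2}}{(f(t),\omega)_{L^2}},\qquad K(t,\tau)=\frac{(\mathcal L^sE_s(t-\tau)f(\tau),\omega)_{L^2}}{(f(t),\omega)_{L^2}}\quad(0\le\tau\le t\le T).$$ Then: (a) if $r\in C[0,T]$ and $(u_r(t),\omega)_{L^2}=w(t)$ for all $t\in[0,T]$, then $r$ satisfies the Volterra equation $$r(t)=g(t)+\int_0^tK(t,\tau)r(\tau)\,d\tau,\qquad0\le t\le T;$$ (b) this Volterra equation has a unique continuous solution $r$ on $[0,T]$; (c) for this solution $r$, the mild solution $u_r$ satisfies $(u_r(t),\omega)_{L^2}=w(t)$ for all $t\in[0,T]$.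
   Context: Let $l,T>0$, $0<s<1$. $\mathcal L=-d^2/dx^2$ with domain $H^2(0,l)\cap H^1_0(0,l)$ is the Dirichlet Laplacian on $L^2(0,l)$, with orthonormal eigenbasis $\phi_k(x)=\sqrt{2/l}\,\sin(k\pi x/l)$ and eigenvalues $\lambda_k=(k\pi/l)^2$, $k\ge1$. The spectral fractional Laplacian is $\mathcal L^sv=\sum_{k\ge1}\lambda_k^s(v,\phi_k)_{L^2}\phi_k$ with domain $D(\mathcal L^s)=\{v\in L^2(0,l):\sum_k\lambda_k^{2s}|(v,\phi_k)_{L^2}|^2<\infty\}$, equipped with the graph norm. $E_s(t)=e^{-t\mathcal L^s}$ is the analytic contraction semigroup $E_s(t)v=\sum_{k\ge1}e^{-\lambda_k^st}(v,\phi_k)_{L^2}\phi_k$ on $L^2(0,l)$. *)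

theory Defs
  imports "HOL-Analysis.Analysis"
begin

text \<open>
  A type cannot depend on the length \<open>l\<close>, so \<open>L\<^sup>2(0,l)\<close> is rendered as the closed subspace
  of \<open>L\<^sup>2(\<real>)\<close> of (classes of) functions that vanish almost everywhere outside \<open>(0,l)\<close>.
  Borel measurable representatives suffice, since every Lebesgue measurable
  function agrees almost everywhere with a Borel measurable one.
\<close>

definition square_integrable :: "(real \<Rightarrow> real) \<Rightarrow> bool" where
  "square_integrable f \<longleftrightarrow> f \<in> borel_measurable lborel \<and> integrable lborel (\<lambda>x. (f x)\<^sup>2)"

lemma square_integrable_measurable: "square_integrable f \<Longrightarrow> f \<in> borel_measurable lborel"
  by (simp add: square_integrable_def)

lemma square_integrable_zero: "square_integrable (\<lambda>x. 0)"
  by (simp add: square_integrable_def)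

lemma square_integrable_mult:
  assumes "square_integrable f" "square_integrable g"
  shows "integrable lborel (\<lambda>x. f x * g x)"
proof (rule Bochner_Integration.integrable_bound)
  show "integrable lborel (\<lambda>x. (f x)\<^sup>2 + (g x)\<^sup>2)"
    using assms by (simp add: square_integrable_def)
  show "(\<lambda>x. f x * g x) \<in> borel_measurable lborel"
    using assms by (auto simp: square_integrable_def)
  have "\<bar>a * b\<bar> \<le> \<bar>a\<^sup>2 + b\<^sup>2\<bar>" for a b :: real
  proof -
    have "0 \<le> \<bar>a\<bar> * \<bar>b\<bar>" "0 \<le> a\<^sup>2 + b\<^sup>2" by simp_all
    moreover have "2 * (\<bar>a\<bar> * \<bar>b\<bar>) \<le> a\<^sup>2 + b\<^sup>2"
      using sum_squares_bound[of "\<bar>a\<bar>" "\<bar>b\<bar>"] by (simp add: mult.assoc)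
    ultimately show ?thesis unfolding abs_mult by linarith
  qed
  then show "AE x in lborel. norm (f x * g x) \<le> norm ((f x)\<^sup>2 + (g x)\<^sup>2)"
    by simp
qed

lemma square_integrable_add:
  assumes "square_integrable f" "square_integrable g"
  shows "square_integrable (\<lambda>x. f x + g x)"
  using assms square_integrable_mult[OF assms]
  by (auto simp: square_integrable_def power2_sum mult.assoc)

lemma square_integrable_scale:
  "square_integrable f \<Longrightarrow> square_integrable (\<lambda>x. c * f x)"
  by (auto simp: square_integrable_def power_mult_distrib)

lemma square_integrable_minus:
  "square_integrable f \<Longrightarrow> square_integrable (\<lambda>x. - f x)"
  by (auto simp: square_integrable_def)

lemma square_integrable_diff:
  assumes "square_integrable f" "square_integrable g"
  shows "square_integrable (\<lambda>x. f x - g x)"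
  using square_integrable_add[OF assms(1) square_integrable_minus[OF assms(2)]] by simp

quotient_type L2 = "real \<Rightarrow> real" / partial:
  "\<lambda>f g. square_integrable f \<and> square_integrable g \<and> (AE x in lborel. f x = g x)"
proof (rule part_equivpI)
  show "\<exists>f. square_integrable f \<and> square_integrable f \<and> (AE x in lborel. f x = f x)"
    using square_integrable_zero by auto
  show "symp (\<lambda>f g. square_integrable f \<and> square_integrable g \<and> (AE x in lborel. f x = g x))"
    by (auto intro!: sympI elim: eventually_mono)
  show "transp (\<lambda>f g. square_integrable f \<and> square_integrable g \<and> (AE x in lborel. f x = g x))"
  proof (rule transpI, intro conjI, goal_cases)
    case (3 f g h)
    then have "AE x in lborel. f x = g x" "AE x in lborel. g x = h x" by auto
    then show ?case by eventually_elim simp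
  qed auto
qed

instantiation L2 :: real_vector
begin

lift_definition zero_L2 :: L2 is "\<lambda>x. 0"
  by (simp add: square_integrable_zero)

lift_definition plus_L2 :: "L2 \<Rightarrow> L2 \<Rightarrow> L2" is "\<lambda>f g x. f x + g x"
  by (auto intro: square_integrable_add elim: eventually_elim2)

lift_definition uminus_L2 :: "L2 \<Rightarrow> L2" is "\<lambda>f x. - f x"
  by (auto intro: square_integrable_minus elim: eventually_mono)

lift_definition minus_L2 :: "L2 \<Rightarrow> L2 \<Rightarrow> L2" is "\<lambda>f g x. f x - g x"
  by (auto intro: square_integrable_diff elim: eventually_elim2)

lift_definition scaleR_L2 :: "real \<Rightarrow> L2 \<Rightarrow> L2" is "\<lambda>c f x. c * f x"
  by (auto intro: square_integrable_scale elim: eventually_mono)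

instance
proof
  fix a b c :: L2 and r q :: real
  show "a + b + c = a + (b + c)"
    by transfer (auto simp: add.assoc intro!: square_integrable_add)
  show "a + b = b + a"
    by transfer (auto simp: add.commute intro!: square_integrable_add)
  show "0 + a = a" by transfer auto
  show "- a + a = 0"
    by transfer (auto simp: square_integrable_zero)
  show "a - b = a + - b"
    by transfer (auto intro!: square_integrable_add square_integrable_diff square_integrable_minus)
  show "r *\<^sub>R (a + b) = r *\<^sub>R a + r *\<^sub>R b"
    by transfer (auto simp: distrib_left intro!: square_integrable_add square_integrable_scale)
  show "(r + q) *\<^sub>R a = r *\<^sub>R a + q *\<^sub>R a"
    by transfer (auto simp: distrib_right intro!: square_integrable_add square_integrable_scale)
  show "r *\<^sub>R q *\<^sub>R a = (r * q) *\<^sub>R a"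
    by transfer (auto simp: mult.assoc intro!: square_integrable_scale)
  show "1 *\<^sub>R a = a" by transfer auto
qed

end

instantiation L2 :: real_inner
begin

lift_definition inner_L2 :: "L2 \<Rightarrow> L2 \<Rightarrow> real" is "\<lambda>f g. LINT x|lborel. f x * g x"
proof -
  fix f f' g g' :: "real \<Rightarrow> real"
  assume *: "square_integrable f \<and> square_integrable f' \<and> (AE x in lborel. f x = f' x)"
            "square_integrable g \<and> square_integrable g' \<and> (AE x in lborel. g x = g' x)"
  then have [measurable]: "f \<in> borel_measurable lborel" "f' \<in> borel_measurable lborel"
      "g \<in> borel_measurable lborel" "g' \<in> borel_measurable lborel"
    by (auto dest: square_integrable_measurable)
  have "AE x in lborel. f x * g x = f' x * g' x"
    using * by (auto elim: eventually_elim2)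
  then show "(LINT x|lborel. f x * g x) = (LINT x|lborel. f' x * g' x)"
    by (intro integral_cong_AE) auto
qed

definition norm_L2 :: "L2 \<Rightarrow> real" where "norm_L2 v = sqrt (inner v v)"
definition sgn_L2 :: "L2 \<Rightarrow> L2" where "sgn_L2 v = v /\<^sub>R norm v"
definition dist_L2 :: "L2 \<Rightarrow> L2 \<Rightarrow> real" where "dist_L2 v w = norm (v - w)"
definition uniformity_L2 :: "(L2 \<times> L2) filter" where
  "uniformity_L2 = (INF e\<in>{0<..}. principal {(v, w). dist v w < e})"
definition open_L2 :: "L2 set \<Rightarrow> bool" where
  "open_L2 U = (\<forall>x\<in>U. eventually (\<lambda>(x', y). x' = x \<longrightarrow> y \<in> U) uniformity)"

instance
proof
  fix a b c :: L2 and r :: real and U :: "L2 set"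
  show "dist a b = norm (a - b)" by (rule dist_L2_def)
  show "sgn a = a /\<^sub>R norm a" by (rule sgn_L2_def)
  show "uniformity = (INF e\<in>{0<..}. principal {(x, y :: L2). dist x y < e})"
    by (rule uniformity_L2_def)
  show "open U = (\<forall>x\<in>U. eventually (\<lambda>(x', y). x' = x \<longrightarrow> y \<in> U) uniformity)"
    by (rule open_L2_def)
  show "inner a b = inner b a"
    by transfer (simp add: mult.commute)
  show "inner (a + b) c = inner a c + inner b c"
    by transfer (simp add: distrib_right square_integrable_mult)
  show "inner (r *\<^sub>R a) b = r * inner a b"
    by transfer (simp add: mult.assoc)
  show "0 \<le> inner a a" by transfer simp
  show "inner a a = 0 \<longleftrightarrow> a = 0"
  proof transfer
    fix f :: "real \<Rightarrow> real"
    assume f: "square_integrable f \<and> square_integrable f \<and> (AE x in lborel. f x = f x)"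
    then have "integrable lborel (\<lambda>x. f x * f x)"
      by (auto intro: square_integrable_mult)
    then have "(LINT x|lborel. f x * f x) = 0 \<longleftrightarrow> (AE x in lborel. f x * f x = 0)"
      by (intro integral_nonneg_eq_0_iff_AE) auto
    then show "(LINT x|lborel. f x * f x) = 0 \<longleftrightarrow>
        (square_integrable f \<and> square_integrable (\<lambda>x. 0) \<and> (AE x in lborel. f x = 0))"
      using f square_integrable_zero by simp
  qed
  show "norm a = sqrt (inner a a)" by (rule norm_L2_def)
qed

end

text \<open>Completeness (Riesz--Fischer), so that the integral of a continuous \<open>L\<^sup>2\<close>-valued
  function over a compact interval exists.\<close>

lemma nn_integral_square_eq_inner:
  assumes "square_integrable h"
  shows "(\<integral>\<^sup>+x. ennreal ((h x)\<^sup>2) \<partial>lborel) = ennreal (LINT x|lborel. h x * h x)"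
  using assms by (subst nn_integral_eq_integral) (auto simp: square_integrable_def power2_eq_square)

lemma L2_representatives:
  fixes X :: "nat \<Rightarrow> L2"
  obtains f where "\<And>n. square_integrable (f n)" "\<And>n. abs_L2 (f n) = X n"
proof
  fix n
  have Q: "Quotient (\<lambda>f g. square_integrable f \<and> square_integrable g \<and> (AE x in lborel. f x = g x))
      abs_L2 rep_L2 cr_L2" by (rule Quotient_L2)
  show "square_integrable (rep_L2 (X n))"
    using Quotient_rep_reflp[OF Q] by auto
  show "abs_L2 (rep_L2 (X n)) = X n"
    using Quotient_abs_rep[OF Q] .
qed

lemma inner_abs_L2:
  assumes "square_integrable f" "square_integrable g"
  shows "inner (abs_L2 f) (abs_L2 g) = (LINT x|lborel. f x * g x)"
  using assms by (intro inner_L2.abs_eq) auto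

lemma norm_abs_L2_diff:
  assumes "square_integrable f" "square_integrable g"
  shows "ennreal ((norm (abs_L2 f - abs_L2 g))\<^sup>2) = (\<integral>\<^sup>+x. ennreal ((f x - g x)\<^sup>2) \<partial>lborel)"
proof -
  have d: "square_integrable (\<lambda>x. f x - g x)"
    using assms by (rule square_integrable_diff)
  have "abs_L2 f - abs_L2 g = abs_L2 (\<lambda>x. f x - g x)"
    using assms by (intro minus_L2.abs_eq) auto
  then show ?thesis
    by (simp add: power2_norm_eq_inner inner_abs_L2[OF d d] nn_integral_square_eq_inner[OF d])
qed

instance L2 :: complete_space
proof
  fix X :: "nat \<Rightarrow> L2"
  assume X: "Cauchy X"
  have "\<exists>N. \<forall>m\<ge>N. \<forall>n\<ge>N. norm (X m - X n) < (1/4) ^ k" for k :: nat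
    using X by (intro CauchyD) auto
  then obtain N where N: "\<And>k m n. m \<ge> N k \<Longrightarrow> n \<ge> N k \<Longrightarrow> norm (X m - X n) < (1/4) ^ k"
    by metis
  define r where "r k = (\<Sum>i\<le>k. N i) + k" for k
  have r: "strict_mono r"
    by (rule strict_mono_Suc_iff[THEN iffD2]) (simp add: r_def)
  have rN: "N k \<le> r m" if "k \<le> m" for k m
  proof -
    have "N k \<le> (\<Sum>i\<le>m. N i)" using that by (intro member_le_sum) auto
    then show ?thesis by (simp add: r_def)
  qed
  obtain f where f: "\<And>n. square_integrable (f n)" and fX: "\<And>n. abs_L2 (f n) = X (r n)"
    using L2_representatives[of "\<lambda>n. X (r n)"] by blast
  have [measurable]: "f n \<in> borel_measurable lborel" for n
    using f by (rule square_integrable_measurable)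
  have close: "(\<integral>\<^sup>+x. ennreal ((f m x - f n x)\<^sup>2) \<partial>lborel) \<le> ennreal (((1/4) ^ k)\<^sup>2)"
    if "k \<le> m" "k \<le> n" for k m n
  proof -
    have "norm (X (r m) - X (r n)) \<le> (1/4) ^ k"
      using N[of k "r m" "r n"] rN that by (simp add: less_imp_le)
    then show ?thesis
      unfolding norm_abs_L2_diff[OF f f, symmetric] fX
      by (intro ennreal_leI power_mono) auto
  qed
  have "(\<integral>\<^sup>+x. (\<Sum>n. ennreal (4 ^ n * (f (Suc n) x - f n x)\<^sup>2)) \<partial>lborel)
      = (\<Sum>n. \<integral>\<^sup>+x. ennreal (4 ^ n * (f (Suc n) x - f n x)\<^sup>2) \<partial>lborel)"
    by (intro nn_integral_suminf) measurable
  also have "\<dots> \<le> (\<Sum>n. ennreal ((1/4) ^ n))"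
  proof (intro suminf_le)
    fix n
    have "(\<integral>\<^sup>+x. ennreal (4 ^ n * (f (Suc n) x - f n x)\<^sup>2) \<partial>lborel)
        = ennreal (4 ^ n) * (\<integral>\<^sup>+x. ennreal ((f (Suc n) x - f n x)\<^sup>2) \<partial>lborel)"
      by (simp add: ennreal_mult nn_integral_cmult)
    also have "\<dots> \<le> ennreal (4 ^ n) * ennreal (((1/4) ^ n)\<^sup>2)"
      by (intro mult_left_mono close) auto
    also have "\<dots> = ennreal ((1/4) ^ n)"
      by (subst ennreal_mult[symmetric]) (auto simp: power2_eq_square power_one_over)
    finally show "(\<integral>\<^sup>+x. ennreal (4 ^ n * (f (Suc n) x - f n x)\<^sup>2) \<partial>lborel) \<le> ennreal ((1/4) ^ n)" .
  qed auto
  also have "\<dots> < \<infinity>"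
    by (subst suminf_ennreal2) (auto intro!: summable_geometric)
  finally have "AE x in lborel. (\<Sum>n. ennreal (4 ^ n * (f (Suc n) x - f n x)\<^sup>2)) \<noteq> \<infinity>"
    by (intro nn_integral_noteq_infinite) auto
  then have conv: "AE x in lborel. convergent (\<lambda>n. f n x)"
  proof eventually_elim
    case (elim x)
    let ?a = "\<lambda>n. 4 ^ n * (f (Suc n) x - f n x)\<^sup>2"
    have "summable ?a"
      using elim by (intro summable_suminf_not_top) auto
    then have "?a \<longlonglongrightarrow> 0" by (rule summable_LIMSEQ_zero)
    then have "eventually (\<lambda>n. ?a n < 1) sequentially"
      by (rule order_tendstoD) simp
    then have ev: "eventually (\<lambda>n. norm (f (Suc n) x - f n x) \<le> (1/2) ^ n) sequentially"
    proof eventually_elim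
      case (elim n)
      have "(2 ^ n * \<bar>f (Suc n) x - f n x\<bar>)\<^sup>2 = ?a n"
        by (simp add: power_mult_distrib power_mult[symmetric] mult.commute[of n]) (simp add: power_mult)
      then have "(2 ^ n * \<bar>f (Suc n) x - f n x\<bar>)\<^sup>2 \<le> 1\<^sup>2"
        using elim by simp
      then have "2 ^ n * \<bar>f (Suc n) x - f n x\<bar> \<le> 1"
        by (rule power2_le_imp_le) simp
      then show ?case
        by (simp add: field_simps power_one_over)
    qed
    have "summable (\<lambda>n. f (Suc n) x - f n x)"
      by (rule summable_comparison_test_ev[OF ev]) (simp add: summable_geometric)
    then have "convergent (\<lambda>n. \<Sum>i<n. f (Suc i) x - f i x)"
      by (simp add: summable_iff_convergent)
    then have "convergent (\<lambda>n. (f n x - f 0 x) + f 0 x)"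
      by (intro convergent_add convergent_const) (simp add: sum_lessThan_telescope[of "\<lambda>i. f i x"])
    then show ?case by simp
  qed
  define g where "g x = lim (\<lambda>n. f n x)" for x
  have [measurable]: "g \<in> borel_measurable lborel"
    unfolding g_def[abs_def] by (rule borel_measurable_lim_metric) measurable
  have lim: "AE x in lborel. (\<lambda>n. f n x) \<longlonglongrightarrow> g x"
    using conv by (auto simp: g_def convergent_LIMSEQ_iff)
  have fatou: "(\<integral>\<^sup>+x. ennreal ((g x - f n x)\<^sup>2) \<partial>lborel) \<le> ennreal (((1/4) ^ k)\<^sup>2)"
    if "k \<le> n" for k n
  proof -
    have "(\<integral>\<^sup>+x. ennreal ((g x - f n x)\<^sup>2) \<partial>lborel)
        = (\<integral>\<^sup>+x. liminf (\<lambda>m. ennreal ((f m x - f n x)\<^sup>2)) \<partial>lborel)"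
    proof (intro nn_integral_cong_AE)
      show "AE x in lborel. ennreal ((g x - f n x)\<^sup>2) = liminf (\<lambda>m. ennreal ((f m x - f n x)\<^sup>2))"
        using lim
      proof eventually_elim
        case (elim x)
        have "(\<lambda>m. ennreal ((f m x - f n x)\<^sup>2)) \<longlonglongrightarrow> ennreal ((g x - f n x)\<^sup>2)"
          by (intro tendsto_intros elim)
        then show ?case
          by (rule lim_imp_Liminf[OF sequentially_bot, symmetric])
      qed
    qed
    also have "\<dots> \<le> liminf (\<lambda>m. \<integral>\<^sup>+x. ennreal ((f m x - f n x)\<^sup>2) \<partial>lborel)"
      by (intro nn_integral_liminf) measurable
    also have "\<dots> \<le> ennreal (((1/4) ^ k)\<^sup>2)"
    proof -
      have "liminf (\<lambda>m. \<integral>\<^sup>+x. ennreal ((f m x - f n x)\<^sup>2) \<partial>lborel)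
          \<le> liminf (\<lambda>m::nat. ennreal (((1/4) ^ k)\<^sup>2))"
        by (intro Liminf_mono eventually_mono[OF eventually_ge_at_top[of k]]) (intro close that)
      then show ?thesis by (simp add: Liminf_const)
    qed
    finally show ?thesis .
  qed
  have "(\<integral>\<^sup>+x. ennreal ((g x - f 0 x)\<^sup>2) \<partial>lborel) < \<infinity>"
    using fatou[of 0 0] by (simp add: le_less_trans)
  then have "square_integrable (\<lambda>x. g x - f 0 x)"
    unfolding square_integrable_def by (auto intro!: integrableI_nonneg)
  then have g: "square_integrable g"
    using square_integrable_add[OF _ f[of 0]] by fastforce
  have gn: "norm (abs_L2 g - X (r n)) \<le> (1/4) ^ n" for n
  proof -
    have "ennreal ((norm (abs_L2 g - X (r n)))\<^sup>2) \<le> ennreal (((1/4) ^ n)\<^sup>2)"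
      using norm_abs_L2_diff[OF g f, of n] fatou[of n n] by (simp add: fX)
    then have "(norm (abs_L2 g - X (r n)))\<^sup>2 \<le> ((1/4) ^ n)\<^sup>2"
      by (simp only: ennreal_le_iff zero_le_power2)
    then show ?thesis
      by (rule power2_le_imp_le) simp
  qed
  have "(\<lambda>n. (1/4::real) ^ n) \<longlonglongrightarrow> 0"
    by (rule LIMSEQ_realpow_zero) auto
  then have "(\<lambda>n. X (r n) - abs_L2 g) \<longlonglongrightarrow> 0"
    by (rule Lim_null_comparison[rotated]) (simp add: norm_minus_commute gn)
  then have "(X \<circ> r) \<longlonglongrightarrow> abs_L2 g"
    by (simp add: LIM_zero_iff comp_def)
  then have "X \<longlonglongrightarrow> abs_L2 g"
    using X r Cauchy_converges_subseq by blast
  then show "convergent X" by (auto simp: convergent_def)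
qed

instance L2 :: banach ..

lift_definition vanishes_outside :: "real set \<Rightarrow> L2 \<Rightarrow> bool" is
  "\<lambda>S f. AE x in lborel. x \<notin> S \<longrightarrow> f x = 0"
proof -
  fix S :: "real set" and f g :: "real \<Rightarrow> real"
  assume "square_integrable f \<and> square_integrable g \<and> (AE x in lborel. f x = g x)"
  then have "AE x in lborel. (x \<notin> S \<longrightarrow> f x = 0) = (x \<notin> S \<longrightarrow> g x = 0)"
    by (auto elim: eventually_mono)
  then show "(AE x in lborel. x \<notin> S \<longrightarrow> f x = 0) = (AE x in lborel. x \<notin> S \<longrightarrow> g x = 0)"
    by (rule eventually_subst)
qed

definition L2_on :: "real \<Rightarrow> L2 set" where
  "L2_on l = {v. vanishes_outside {0<..<l} v}"

text \<open>Modes are indexed by \<open>k \<ge> 1\<close>; the series below therefore run over \<open>Suc k\<close>.\<close>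

lift_definition eigenfun :: "real \<Rightarrow> nat \<Rightarrow> L2" is
  "\<lambda>l k x. indicator {0<..<l} x * (sqrt (2 / l) * sin (real k * pi * x / l))"
proof -
  fix l :: real and k :: nat
  let ?h = "\<lambda>x. indicator {0<..<l} x * (sqrt (2 / l) * sin (real k * pi * x / l))"
  have "integrable lborel (\<lambda>x. (?h x)\<^sup>2)"
  proof (rule Bochner_Integration.integrable_bound)
    show "integrable lborel (\<lambda>x. (sqrt (2 / l))\<^sup>2 * indicat_real {0<..<l} x)"
      by (intro integrable_mult_right) (cases "0 \<le> l"; simp)
    have "(sin y)\<^sup>2 \<le> 1" for y :: real
      by (simp add: abs_square_le_1)
    then show "AE x in lborel. norm ((?h x)\<^sup>2) \<le> norm ((sqrt (2 / l))\<^sup>2 * indicat_real {0<..<l} x)"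
      by (auto simp: indicator_def power_mult_distrib divide_right_mono)
  qed measurable
  then have "square_integrable ?h"
    by (simp add: square_integrable_def)
  then show "square_integrable ?h \<and> square_integrable ?h \<and> (AE x in lborel. ?h x = ?h x)"
    by simp
qed

definition eigenvalue :: "real \<Rightarrow> nat \<Rightarrow> real" where
  "eigenvalue l k = (real k * pi / l)\<^sup>2"

definition frac_dom :: "real \<Rightarrow> real \<Rightarrow> L2 set" where
  "frac_dom l s =
    {v \<in> L2_on l. summable (\<lambda>k. eigenvalue l (Suc k) powr (2 * s) * \<bar>v \<bullet> eigenfun l (Suc k)\<bar>\<^sup>2)}"

definition frac_lap :: "real \<Rightarrow> real \<Rightarrow> L2 \<Rightarrow> L2" where
  "frac_lap l s v =
    (\<Sum>k. (eigenvalue l (Suc k) powr s * (v \<bullet> eigenfun l (Suc k))) *\<^sub>R eigenfun l (Suc k))"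

definition graph_norm :: "real \<Rightarrow> real \<Rightarrow> L2 \<Rightarrow> real" where
  "graph_norm l s v = sqrt ((norm v)\<^sup>2 + (norm (frac_lap l s v))\<^sup>2)"

definition continuous_into_dom :: "real \<Rightarrow> real \<Rightarrow> real set \<Rightarrow> (real \<Rightarrow> L2) \<Rightarrow> bool" where
  "continuous_into_dom l s S f \<longleftrightarrow>
    (\<forall>t\<in>S. f t \<in> frac_dom l s) \<and>
    (\<forall>t\<in>S. ((\<lambda>t'. graph_norm l s (f t' - f t)) \<longlongrightarrow> 0) (at t within S))"

definition frac_semigroup :: "real \<Rightarrow> real \<Rightarrow> real \<Rightarrow> L2 \<Rightarrow> L2" where
  "frac_semigroup l s t v =
    (\<Sum>k. (exp (- (eigenvalue l (Suc k) powr s) * t) * (v \<bullet> eigenfun l (Suc k)))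
      *\<^sub>R eigenfun l (Suc k))"

definition mild_solution ::
    "real \<Rightarrow> real \<Rightarrow> L2 \<Rightarrow> (real \<Rightarrow> L2) \<Rightarrow> (real \<Rightarrow> real) \<Rightarrow> real \<Rightarrow> L2" where
  "mild_solution l s \<phi> f r t =
    frac_semigroup l s t \<phi> + integral {0..t} (\<lambda>\<tau>. frac_semigroup l s (t - \<tau>) (r \<tau> *\<^sub>R f \<tau>))"

definition volterra_rhs ::
    "real \<Rightarrow> real \<Rightarrow> L2 \<Rightarrow> (real \<Rightarrow> L2) \<Rightarrow> L2 \<Rightarrow> (real \<Rightarrow> real) \<Rightarrow> real \<Rightarrow> real" where
  "volterra_rhs l s \<phi> f \<omega> w' t =
    (w' t + frac_lap l s (frac_semigroup l s t \<phi>) \<bullet> \<omega>) / (f t \<bullet> \<omega>)"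

definition volterra_kernel ::
    "real \<Rightarrow> real \<Rightarrow> (real \<Rightarrow> L2) \<Rightarrow> L2 \<Rightarrow> real \<Rightarrow> real \<Rightarrow> real" where
  "volterra_kernel l s f \<omega> t \<tau> =
    (frac_lap l s (frac_semigroup l s (t - \<tau>) (f \<tau>)) \<bullet> \<omega>) / (f t \<bullet> \<omega>)"

definition solves_volterra ::
    "real \<Rightarrow> (real \<Rightarrow> real) \<Rightarrow> (real \<Rightarrow> real \<Rightarrow> real) \<Rightarrow> (real \<Rightarrow> real) \<Rightarrow> bool" where
  "solves_volterra T g K r \<longleftrightarrow>
    (\<forall>t\<in>{0..T}. r t = g t + integral {0..t} (\<lambda>\<tau>. K t \<tau> * r \<tau>))"

end

(*
  The mild solution u_r lies in the closed span of the sines, and its Fourier coefficients solve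
  scalar linear equations.  Integrating these mode by mode and reassembling (the sine system is
  total in L^2(0,l)) yields, without any interchange of integrals or series, the L^2 identity
    u_r(t) = phi + int_0^t V,   V = r f - E(.) L^s phi - int_0^. E(. - tau) r(tau) L^s f(tau) dtau.
  Pairing with omega and using w(0) = (phi, omega) gives
    (u_r(t), omega) - w(t) = int_0^t (f, omega) (r - g - int_0^. K r).
  The integrand is continuous and (f, omega) does not vanish, so the overdetermination condition
  is equivalent to the Volterra equation, whose kernel is continuous on the triangle.
*)
theory Submission
  imports Defs
begin

section \<open>Diagonal operators over an orthonormal sequence\<close>

text \<open>Since omega is merely square integrable, L^s cannot be shifted onto it in the pairing;
  the data have to absorb it. The general smoothing bound for L^s E(t - tau) is of order 1/(t -
  tau), which is not integrable up to tau = t. For f(tau) in the domain, L^s E(t - tau) f(tau) = E(t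
  - tau) L^s f(tau), and this is continuous up to the diagonal. Graph norm continuity of f is used
  precisely as continuity of f and of L^s f. The second obstacle is that L^2(0,l) sits inside L^2 of
  the whole line, where the eigenfunctions are not total, so equal Fourier coefficients give equal
  vectors only within their closed span. Membership in it is therefore tracked throughout. Totality
  of the sines is invoked for phi and the values of f alone; diagonal operators and integrals then
  stay in the span by themselves.\<close>

locale orthonormal_sequence =
  fixes e :: "nat \<Rightarrow> 'a::{real_inner,banach}"
  assumes inner_e: "e i \<bullet> e j = (if i = j then 1 else 0)"
begin

text \<open>\<open>suminf\<close> makes this a total function. For unbounded \<open>c\<close> it is
  the intended operator only where the numbers \<open>c k * (v \<bullet> e k)\<close> are square
  summable, so that condition recurs as a hypothesis.\<close>

definition diag :: "(nat \<Rightarrow> real) \<Rightarrow> 'a \<Rightarrow> 'a" where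
  "diag c v = (\<Sum>k. (c k * (v \<bullet> e k)) *\<^sub>R e k)"

text \<open>As a double orthogonal complement, membership is inherited by integrals and is checked on
  \<open>L2_on l\<close> by totality alone.\<close>

definition closed_span :: "'a set" where
  "closed_span = {x. \<forall>y. (\<forall>k. y \<bullet> e k = 0) \<longrightarrow> x \<bullet> y = 0}"

lemma inner_sum_e:
  assumes "finite A"
  shows "(\<Sum>k\<in>A. c k *\<^sub>R e k) \<bullet> e j = (if j \<in> A then c j else 0)"
  using assms by (simp add: inner_sum_left inner_e if_distrib cong: if_cong)

lemma norm_sum_e:
  assumes "finite A"
  shows "(norm (\<Sum>k\<in>A. c k *\<^sub>R e k))\<^sup>2 = (\<Sum>k\<in>A. (c k)\<^sup>2)"
proof -
  have "(norm (\<Sum>k\<in>A. c k *\<^sub>R e k))\<^sup>2 = (\<Sum>j\<in>A. c j * ((\<Sum>k\<in>A. c k *\<^sub>R e k) \<bullet> e j))"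
    by (simp add: power2_norm_eq_inner inner_sum_right[of _ "\<lambda>k. c k *\<^sub>R e k" A])
  also have "\<dots> = (\<Sum>k\<in>A. (c k)\<^sup>2)"
    by (rule sum.cong) (simp_all add: inner_sum_e assms power2_eq_square)
  finally show ?thesis .
qed

text \<open>Pythagoras turns the Cauchy criterion for the squared coefficients into the one for the
  vectors; completeness of the space does the rest.\<close>

lemma summable_e:
  assumes "summable (\<lambda>k. (c k)\<^sup>2)"
  shows "summable (\<lambda>k. c k *\<^sub>R e k)"
  unfolding summable_Cauchy
proof (intro allI impI)
  fix \<epsilon> :: real assume "0 < \<epsilon>"
  then obtain N where N: "\<And>m n. m \<ge> N \<Longrightarrow> norm (\<Sum>k=m..<n. (c k)\<^sup>2) < \<epsilon>\<^sup>2"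
    using assms unfolding summable_Cauchy by (meson zero_less_power)
  have "norm (\<Sum>k=m..<n. c k *\<^sub>R e k) < \<epsilon>" if "m \<ge> N" for m n
  proof (rule power2_less_imp_less)
    show "(norm (\<Sum>k=m..<n. c k *\<^sub>R e k))\<^sup>2 < \<epsilon>\<^sup>2"
      using N[OF that, of n] by (simp add: norm_sum_e sum_nonneg)
  qed (use \<open>0 < \<epsilon>\<close> in simp)
  then show "\<exists>N. \<forall>m\<ge>N. \<forall>n. norm (\<Sum>k=m..<n. c k *\<^sub>R e k) < \<epsilon>" by blast
qed

lemma inner_suminf_e:
  assumes "summable (\<lambda>k. (c k)\<^sup>2)"
  shows "(\<Sum>k. c k *\<^sub>R e k) \<bullet> e j = c j"
proof -
  have "(\<lambda>k. (c k *\<^sub>R e k) \<bullet> e j) sums ((\<Sum>k. c k *\<^sub>R e k) \<bullet> e j)"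
    by (rule bounded_linear.sums[OF bounded_linear_inner_left summable_sums[OF summable_e[OF assms]]])
  moreover have "(\<lambda>k. (c k *\<^sub>R e k) \<bullet> e j) sums c j"
    using sums_single[of j c] by (simp add: inner_e if_distrib eq_commute cong: if_cong)
  ultimately show ?thesis by (rule sums_unique2)
qed

lemma norm_suminf_e_le:
  assumes "summable (\<lambda>k. (c k)\<^sup>2)" "(\<Sum>k. (c k)\<^sup>2) \<le> B\<^sup>2" "0 \<le> B"
  shows "norm (\<Sum>k. c k *\<^sub>R e k) \<le> B"
proof (rule Lim_bounded)
  show "(\<lambda>n. norm (\<Sum>k<n. c k *\<^sub>R e k)) \<longlonglongrightarrow> norm (\<Sum>k. c k *\<^sub>R e k)"
    using summable_LIMSEQ[OF summable_e[OF assms(1)]] by (rule tendsto_norm)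
  have "norm (\<Sum>k<n. c k *\<^sub>R e k) \<le> B" for n
  proof (rule power2_le_imp_le)
    have "(\<Sum>k<n. (c k)\<^sup>2) \<le> (\<Sum>k. (c k)\<^sup>2)"
      by (rule sum_le_suminf) (use assms in auto)
    then show "(norm (\<Sum>k<n. c k *\<^sub>R e k))\<^sup>2 \<le> B\<^sup>2"
      using assms(2) by (simp add: norm_sum_e)
  qed (rule assms(3))
  then show "\<forall>n\<ge>0. norm (\<Sum>k<n. c k *\<^sub>R e k) \<le> B" by simp
qed

text \<open>With \<open>p\<close> the orthogonal projection of \<open>v\<close> on the first
  \<open>n\<close> vectors, \<open>v \<bullet> p\<close> and \<open>p \<bullet> p\<close> both equal
  the sum, so the claim is the nonnegativity of the squared norm of \<open>v - p\<close>.\<close>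

lemma bessel_sum: "(\<Sum>k<n. (v \<bullet> e k)\<^sup>2) \<le> (norm v)\<^sup>2"
proof -
  define p where "p = (\<Sum>k<n. (v \<bullet> e k) *\<^sub>R e k)"
  have "v \<bullet> p = (\<Sum>k<n. (v \<bullet> e k)\<^sup>2)" "p \<bullet> p = (\<Sum>k<n. (v \<bullet> e k)\<^sup>2)"
    using norm_sum_e[of "{..<n}" "\<lambda>k. v \<bullet> e k"]
    by (simp_all add: p_def inner_sum_right[of v] power2_eq_square power2_norm_eq_inner[unfolded power2_eq_square])
  moreover have "0 \<le> (v - p) \<bullet> (v - p)" by simp
  ultimately show ?thesis
    by (simp add: inner_diff_left inner_diff_right power2_norm_eq_inner inner_commute)
qed

lemma bessel_summable: "summable (\<lambda>k. (v \<bullet> e k)\<^sup>2)"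
  by (rule bounded_imp_summable[where B = "(norm v)\<^sup>2"])
    (use bessel_sum[of v "Suc n" for n] in \<open>simp_all add: lessThan_Suc_atMost\<close>)

lemma bessel: "(\<Sum>k. (v \<bullet> e k)\<^sup>2) \<le> (norm v)\<^sup>2"
  by (rule suminf_le_const[OF bessel_summable bessel_sum])

lemma summable_diag_coeff:
  assumes "\<And>k. \<bar>c k\<bar> \<le> 1"
  shows "summable (\<lambda>k. (c k * (v \<bullet> e k))\<^sup>2)"
    and "(\<Sum>k. (c k * (v \<bullet> e k))\<^sup>2) \<le> (norm v)\<^sup>2"
proof -
  have le: "(c k * (v \<bullet> e k))\<^sup>2 \<le> (v \<bullet> e k)\<^sup>2" for k
    using assms[of k] by (simp add: power_mult_distrib abs_square_le_1 mult_left_le_one_le)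
  show s: "summable (\<lambda>k. (c k * (v \<bullet> e k))\<^sup>2)"
    by (rule summable_comparison_test'[OF bessel_summable, of 0]) (use le in simp)
  show "(\<Sum>k. (c k * (v \<bullet> e k))\<^sup>2) \<le> (norm v)\<^sup>2"
    using suminf_le[OF le s bessel_summable] bessel by (rule order_trans)
qed

lemma norm_diag_le:
  assumes "\<And>k. \<bar>c k\<bar> \<le> 1"
  shows "norm (diag c v) \<le> norm v"
  unfolding diag_def by (rule norm_suminf_e_le[OF summable_diag_coeff[OF assms]]) simp

lemma inner_diag:
  assumes "summable (\<lambda>k. (c k * (v \<bullet> e k))\<^sup>2)"
  shows "diag c v \<bullet> e j = c j * (v \<bullet> e j)"
  unfolding diag_def by (rule inner_suminf_e[OF assms])

lemma diag_diff:
  assumes "summable (\<lambda>k. (c k * (v \<bullet> e k))\<^sup>2)" "summable (\<lambda>k. (c k * (w \<bullet> e k))\<^sup>2)"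
  shows "diag c (v - w) = diag c v - diag c w"
  using suminf_diff[OF summable_e[OF assms(1)] summable_e[OF assms(2)]]
  by (simp add: diag_def inner_diff_left right_diff_distrib scaleR_diff_left)

lemma diag_scaleR:
  assumes "summable (\<lambda>k. (c k * (v \<bullet> e k))\<^sup>2)"
  shows "diag c (r *\<^sub>R v) = r *\<^sub>R diag c v"
  using suminf_scaleR_right[OF summable_e[OF assms], of r] by (simp add: diag_def mult.left_commute)

text \<open>Once the coefficients of \<open>diag c v\<close> are known, both sides are the same
  series term by term, convergent or not. Hence \<open>d\<close> may be unbounded, as in
  \<open>diag_semigroup_commute\<close>.\<close>

lemma diag_diag:
  assumes "summable (\<lambda>k. (c k * (v \<bullet> e k))\<^sup>2)"
  shows "diag d (diag c v) = diag (\<lambda>k. d k * c k) v"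
  by (simp add: diag_def[of d] inner_diag[OF assms]) (simp add: diag_def mult.assoc)

lemma closed_span_diag:
  assumes "summable (\<lambda>k. (c k * (v \<bullet> e k))\<^sup>2)"
  shows "diag c v \<in> closed_span"
proof -
  have "diag c v \<bullet> y = 0" if y: "\<forall>k. y \<bullet> e k = 0" for y
  proof -
    have "(\<lambda>k. ((c k * (v \<bullet> e k)) *\<^sub>R e k) \<bullet> y) sums (diag c v \<bullet> y)"
      unfolding diag_def
      by (rule bounded_linear.sums[OF bounded_linear_inner_left summable_sums[OF summable_e[OF assms]]])
    then show ?thesis using y by (simp add: inner_commute[of "e _"] sums_iff)
  qed
  then show ?thesis by (simp add: closed_span_def)
qed

lemma closed_span_add: "x \<in> closed_span \<Longrightarrow> y \<in> closed_span \<Longrightarrow> x + y \<in> closed_span"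
  by (simp add: closed_span_def inner_add_left)

lemma closed_span_diff: "x \<in> closed_span \<Longrightarrow> y \<in> closed_span \<Longrightarrow> x - y \<in> closed_span"
  by (simp add: closed_span_def inner_diff_left)

lemma closed_span_scaleR: "x \<in> closed_span \<Longrightarrow> r *\<^sub>R x \<in> closed_span"
  by (simp add: closed_span_def)

lemma closed_span_integral:
  fixes h :: "real \<Rightarrow> 'a"
  assumes "h integrable_on S" "\<And>t. t \<in> S \<Longrightarrow> h t \<in> closed_span"
  shows "integral S h \<in> closed_span"
proof -
  have "integral S h \<bullet> y = 0" if "\<forall>k. y \<bullet> e k = 0" for y
  proof -
    have "integral S h \<bullet> y = integral S (\<lambda>t. h t \<bullet> y)"
      using integral_linear[OF assms(1) bounded_linear_inner_left[of y]] by (simp add: comp_def)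
    also have "\<dots> = integral S (\<lambda>t. 0)"
      using assms(2) that by (intro integral_cong) (auto simp: closed_span_def)
    finally show ?thesis by simp
  qed
  then show ?thesis by (simp add: closed_span_def)
qed

text \<open>The difference lies in the double complement and is orthogonal to every
  \<open>e k\<close>, hence orthogonal to itself. This is how vector identities are recovered from
  scalar ones.\<close>

lemma closed_span_eqI:
  assumes "x \<in> closed_span" "y \<in> closed_span" "\<And>k. x \<bullet> e k = y \<bullet> e k"
  shows "x = y"
proof -
  have "(x - y) \<bullet> (x - y) = 0"
    using closed_span_diff[OF assms(1,2)] assms(3) by (auto simp: closed_span_def inner_diff_left)
  then show ?thesis by simp
qed

end

section \<open>The contraction semigroup of a nonnegative diagonal operator\<close>

locale diagonal_semigroup = orthonormal_sequence e
  for e :: "nat \<Rightarrow> 'a::{real_inner,banach}" +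
  fixes a :: "nat \<Rightarrow> real"
  assumes a_nonneg: "0 \<le> a k"
begin

text \<open>At \<open>t = 0\<close> this is the orthogonal projection onto the closed linear span of
  the \<open>e k\<close>, so it fixes only the vectors of that span.\<close>

definition semigroup :: "real \<Rightarrow> 'a \<Rightarrow> 'a" where
  "semigroup t = diag (\<lambda>k. exp (- a k * t))"

text \<open>Only the decay of the coefficients is recorded; a component orthogonal to all
  \<open>e k\<close> is allowed here and is excluded separately by
  \<open>closed_span\<close>.\<close>

definition dom :: "'a set" where
  "dom = {v. summable (\<lambda>k. (a k * (v \<bullet> e k))\<^sup>2)}"

lemma abs_exp_le_1: "0 \<le> t \<Longrightarrow> \<bar>exp (- a k * t)\<bar> \<le> 1"
  using a_nonneg[of k] by simp

lemma semigroup_coeff_summable: "0 \<le> t \<Longrightarrow> summable (\<lambda>k. (exp (- a k * t) * (v \<bullet> e k))\<^sup>2)"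
  by (rule summable_diag_coeff) (rule abs_exp_le_1)

lemma norm_semigroup_le: "0 \<le> t \<Longrightarrow> norm (semigroup t v) \<le> norm v"
  unfolding semigroup_def by (rule norm_diag_le[OF abs_exp_le_1])

lemma inner_semigroup: "0 \<le> t \<Longrightarrow> semigroup t v \<bullet> e k = exp (- a k * t) * (v \<bullet> e k)"
  unfolding semigroup_def by (rule inner_diag[OF semigroup_coeff_summable])

lemma semigroup_closed_span: "0 \<le> t \<Longrightarrow> semigroup t v \<in> closed_span"
  unfolding semigroup_def by (rule closed_span_diag[OF semigroup_coeff_summable])

lemma semigroup_diff: "0 \<le> t \<Longrightarrow> semigroup t (v - w) = semigroup t v - semigroup t w"
  unfolding semigroup_def by (intro diag_diff semigroup_coeff_summable)

lemma semigroup_scaleR: "0 \<le> t \<Longrightarrow> semigroup t (r *\<^sub>R v) = r *\<^sub>R semigroup t v"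
  unfolding semigroup_def by (intro diag_scaleR semigroup_coeff_summable)

lemma dom_scaleR: "v \<in> dom \<Longrightarrow> r *\<^sub>R v \<in> dom"
  unfolding dom_def by (simp add: mult.left_commute[of _ r] power_mult_distrib[of r])

lemma diag_diff_dom: "v \<in> dom \<Longrightarrow> w \<in> dom \<Longrightarrow> diag a (v - w) = diag a v - diag a w"
  by (simp add: dom_def diag_diff)

text \<open>This moves the unbounded operator onto the data, where it meets a contraction. Both
  compositions are one diagonal operator with multiplier
  \<open>a k * exp (- a k * t)\<close>.\<close>

lemma diag_semigroup_commute:
  assumes "v \<in> dom" "0 \<le> t"
  shows "diag a (semigroup t v) = semigroup t (diag a v)"
proof -
  have "diag a (semigroup t v) = diag (\<lambda>k. a k * exp (- a k * t)) v"
    unfolding semigroup_def by (rule diag_diag[OF semigroup_coeff_summable[OF assms(2)]])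
  moreover have "semigroup t (diag a v) = diag (\<lambda>k. exp (- a k * t) * a k) v"
    unfolding semigroup_def by (rule diag_diag) (use assms(1) in \<open>simp add: dom_def\<close>)
  ultimately show ?thesis by (simp add: mult.commute)
qed

text \<open>For finitely many modes the orbit is a finite sum of exponentials. Contractivity makes
  the convergence of these truncations uniform in time, including \<open>t = 0\<close>.\<close>

lemma continuous_on_semigroup_time: "continuous_on {0..} (\<lambda>t. semigroup t v)"
proof (rule uniform_limit_theorem)
  define p where "p n = (\<Sum>k<n. (v \<bullet> e k) *\<^sub>R e k)" for n
  define p' where "p' = (\<Sum>k. (v \<bullet> e k) *\<^sub>R e k)"
  have p_inner: "p n \<bullet> e k = (if k < n then v \<bullet> e k else 0)" for n k
    by (simp add: p_def inner_sum_e)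
  have p: "p \<longlonglongrightarrow> p'"
    unfolding p_def p'_def by (rule summable_LIMSEQ[OF summable_e[OF bessel_summable]])
  \<comment> \<open>The truncations converge to the projection \<open>p'\<close>, which may differ
    from \<open>v\<close>; the semigroup reads only coefficients and cannot tell them apart.\<close>
  have same: "semigroup t p' = semigroup t v" for t
    unfolding semigroup_def diag_def p'_def by (simp add: inner_suminf_e[OF bessel_summable])
  show "\<forall>\<^sub>F n in sequentially. continuous_on {0..} (\<lambda>t. semigroup t (p n))"
  proof (intro always_eventually allI)
    fix n
    have "semigroup t (p n) = (\<Sum>k<n. (exp (- a k * t) * (v \<bullet> e k)) *\<^sub>R e k)" for t
      unfolding semigroup_def diag_def
      by (subst suminf_finite[of "{..<n}"]) (auto simp: p_inner)
    then show "continuous_on {0..} (\<lambda>t. semigroup t (p n))"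
      by (simp add: continuous_intros)
  qed
  show "uniform_limit {0..} (\<lambda>n t. semigroup t (p n)) (\<lambda>t. semigroup t v) sequentially"
  proof (rule uniform_limitI)
    fix \<epsilon> :: real assume "0 < \<epsilon>"
    with p have "\<forall>\<^sub>F n in sequentially. dist (p n) p' < \<epsilon>" by (rule tendstoD)
    then show "\<forall>\<^sub>F n in sequentially. \<forall>t\<in>{0..}. dist (semigroup t (p n)) (semigroup t v) < \<epsilon>"
    proof eventually_elim
      case (elim n)
      show ?case
      proof
        fix t :: real assume "t \<in> {0..}"
        then have "dist (semigroup t (p n)) (semigroup t v) \<le> dist (p n) p'"
          unfolding same[symmetric] dist_norm
          by (subst semigroup_diff[symmetric]) (auto intro: norm_semigroup_le)
        then show "dist (semigroup t (p n)) (semigroup t v) < \<epsilon>" using elim by simp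
      qed
    qed
  qed
qed simp

text \<open>Joint strong continuity: split the increment into
  \<open>semigroup (\<sigma> y) (h y - h x)\<close>, controlled by contractivity, and the change of
  time at the fixed vector \<open>h x\<close>. The general domain lets it serve both curves and the
  triangle of pairs (t, tau).\<close>

lemma continuous_on_semigroup:
  fixes h :: "'b::topological_space \<Rightarrow> 'a"
  assumes "continuous_on S \<sigma>" "continuous_on S h" "\<And>x. x \<in> S \<Longrightarrow> 0 \<le> \<sigma> x"
  shows "continuous_on S (\<lambda>x. semigroup (\<sigma> x) (h x))"
  unfolding continuous_on_def
proof
  fix x assume x: "x \<in> S"
  have "continuous_on S (\<lambda>y. semigroup (\<sigma> y) (h x))"
    by (rule continuous_on_compose2[OF continuous_on_semigroup_time assms(1)]) (use assms(3) in auto)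
  then have 1: "((\<lambda>y. semigroup (\<sigma> y) (h x)) \<longlongrightarrow> semigroup (\<sigma> x) (h x)) (at x within S)"
    using x by (simp add: continuous_on_def)
  have h0: "((\<lambda>y. norm (h y - h x)) \<longlongrightarrow> 0) (at x within S)"
    using assms(2) x by (intro tendsto_norm_zero) (simp add: continuous_on_def LIM_zero)
  have 2: "((\<lambda>y. semigroup (\<sigma> y) (h y) - semigroup (\<sigma> y) (h x)) \<longlongrightarrow> 0) (at x within S)"
  proof (rule Lim_null_comparison[OF _ h0])
    show "\<forall>\<^sub>F y in at x within S. norm (semigroup (\<sigma> y) (h y) - semigroup (\<sigma> y) (h x)) \<le> norm (h y - h x)"
      unfolding eventually_at_filter
      by (intro always_eventually allI impI, subst semigroup_diff[symmetric])
        (use assms(3) in \<open>auto intro: norm_semigroup_le\<close>)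
  qed
  show "((\<lambda>y. semigroup (\<sigma> y) (h y)) \<longlongrightarrow> semigroup (\<sigma> x) (h x)) (at x within S)"
    using tendsto_add[OF 2 1] by simp
qed

end

section \<open>Volterra equations with a continuous kernel\<close>

lemma integral_unit_rescale:
  fixes F :: "real \<Rightarrow> 'a::banach"
  assumes "0 \<le> t" "continuous_on {0..t} F"
  shows "integral {0..t} F = t *\<^sub>R integral {0..1} (\<lambda>\<theta>. F (t * \<theta>))"
proof (cases "t = 0")
  case False
  then have t: "0 < t" using assms(1) by simp
  have "(F has_integral integral {0..t} F) (cbox 0 t)"
    using integrable_integral[OF integrable_continuous_real[OF assms(2)]] by simp
  from has_integral_affinity[OF this, of t 0] t
  have "((\<lambda>\<theta>. F (t * \<theta>)) has_integral (1 / t) *\<^sub>R integral {0..t} F) {0..1}"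
    by simp
  then show ?thesis using t by (simp add: integral_unique)
qed simp

lemma continuous_on_triangle_slice:
  fixes F :: "real \<Rightarrow> real \<Rightarrow> 'a::topological_space"
  assumes "continuous_on {(t, \<tau>). 0 \<le> \<tau> \<and> \<tau> \<le> t \<and> t \<le> T} (\<lambda>(t, \<tau>). F t \<tau>)" "t \<le> T"
  shows "continuous_on {0..t} (F t)"
proof -
  have "continuous_on {0..t} (\<lambda>\<tau>. (\<lambda>(t, \<tau>). F t \<tau>) (t, \<tau>))"
    by (rule continuous_on_compose2[OF assms(1)]) (use assms(2) in \<open>auto intro!: continuous_intros\<close>)
  then show ?thesis by simp
qed

lemma integrable_on_triangle_slice:
  fixes F :: "real \<Rightarrow> real \<Rightarrow> 'a::banach"
  assumes "continuous_on {(t, \<tau>). 0 \<le> \<tau> \<and> \<tau> \<le> t \<and> t \<le> T} (\<lambda>(t, \<tau>). F t \<tau>)" "t \<le> T"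
  shows "F t integrable_on {0..t}"
  by (rule integrable_continuous_real[OF continuous_on_triangle_slice[OF assms]])

text \<open>The substitution tau = t theta fixes the interval to [0,1] and moves \<open>t\<close>
  into the integrand, so continuity in a parameter applies. The prefactor \<open>t\<close> covers
  the degenerate interval at \<open>t = 0\<close>.\<close>

lemma continuous_on_integral_triangle:
  fixes F :: "real \<Rightarrow> real \<Rightarrow> 'a::banach"
  assumes "continuous_on {(t, \<tau>). 0 \<le> \<tau> \<and> \<tau> \<le> t \<and> t \<le> T} (\<lambda>(t, \<tau>). F t \<tau>)"
  shows "continuous_on {0..T} (\<lambda>t. integral {0..t} (F t))"
proof -
  let ?D = "{(t, \<tau>). 0 \<le> \<tau> \<and> \<tau> \<le> t \<and> t \<le> T}"
  have eq: "integral {0..t} (F t) = t *\<^sub>R integral {0..1} (\<lambda>\<theta>. F t (t * \<theta>))"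
    if "t \<in> {0..T}" for t
    using that by (intro integral_unit_rescale continuous_on_triangle_slice[OF assms]) auto
  have "continuous_on ({0..T} \<times> {0..1}) (\<lambda>p. (\<lambda>(t, \<tau>). F t \<tau>) (fst p, fst p * snd p))"
  proof (rule continuous_on_compose2[OF assms])
    show "(\<lambda>p. (fst p, fst p * snd p)) ` ({0..T} \<times> {0..1}) \<subseteq> ?D"
      by (auto simp: mult_left_le)
  qed (intro continuous_intros)
  then have "continuous_on ({0..T} \<times> cbox 0 1) (\<lambda>(t, \<theta>). F t (t * \<theta>))"
    by (simp add: case_prod_unfold)
  then have "continuous_on {0..T} (\<lambda>t. integral (cbox 0 1) (\<lambda>\<theta>. F t (t * \<theta>)))"
    by (rule integral_continuous_on_param)
  then have "continuous_on {0..T} (\<lambda>t. t *\<^sub>R integral {0..1} (\<lambda>\<theta>. F t (t * \<theta>)))"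
    by (intro continuous_intros) simp
  then show ?thesis by (rule continuous_on_eq) (simp only: eq)
qed

text \<open>Bielecki's weighted norm lets the Banach fixed point theorem act on all of [0,T] at
  once. Uniqueness is stated pointwise on [0,T] since the values of \<open>r\<close> elsewhere are
  arbitrary.\<close>

lemma volterra_unique_solution:
  fixes g :: "real \<Rightarrow> real" and K :: "real \<Rightarrow> real \<Rightarrow> real"
  assumes T: "0 \<le> T" and g: "continuous_on {0..T} g"
    and K: "continuous_on {(t, \<tau>). 0 \<le> \<tau> \<and> \<tau> \<le> t \<and> t \<le> T} (\<lambda>(t, \<tau>). K t \<tau>)"
  shows "\<exists>r. continuous_on {0..T} r \<and> solves_volterra T g K r \<and>
    (\<forall>r'. continuous_on {0..T} r' \<longrightarrow> solves_volterra T g K r' \<longrightarrow> (\<forall>t\<in>{0..T}. r' t = r t))"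
proof -
  let ?D = "{(t, \<tau>). 0 \<le> \<tau> \<and> \<tau> \<le> t \<and> t \<le> T} :: (real \<times> real) set"
  have "?D = {p. 0 \<le> snd p} \<inter> {p. snd p \<le> fst p} \<inter> {p. fst p \<le> T}"
    by auto
  also have "closed \<dots>"
    by (intro closed_Int closed_Collect_le continuous_intros)
  finally have "closed ?D" .
  moreover have "?D \<subseteq> cbox (0, 0) (T, T)" by (auto simp: mem_box)
  ultimately have "compact ?D"
    by (meson bounded_cbox bounded_subset compact_eq_bounded_closed)
  then have "bounded ((\<lambda>(t, \<tau>). K t \<tau>) ` ?D)"
    using K by (intro compact_imp_bounded compact_continuous_image)
  then obtain M where "0 < M" and M': "\<forall>x\<in>(\<lambda>(t, \<tau>). K t \<tau>) ` ?D. norm x \<le> M"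
    unfolding bounded_pos by blast
  have M: "\<bar>K t \<tau>\<bar> \<le> M" if "0 \<le> \<tau>" "\<tau> \<le> t" "t \<le> T" for t \<tau>
    using M' that by force
  \<comment> \<open>Weighting by \<open>exp (- L t)\<close> makes the Volterra operator a contraction with constant \<open>M / L\<close>.\<close>
  define L where "L = 2 * M"
  have L: "0 < L" using \<open>0 < M\<close> by (simp add: L_def)
  \<comment> \<open>\<open>bcontfun\<close> consists of functions on the whole line, so functions on
    [0,T] are extended by their end values, by composition with the retraction
    \<open>c\<close>.\<close>
  define c where "c t = max 0 (min T t)" for t
  have c: "c t \<in> {0..T}" for t using T by (auto simp: c_def)
  have c_id: "c t = t" if "t \<in> {0..T}" for t using that by (auto simp: c_def)
  have cont_c: "continuous_on UNIV c" unfolding c_def by (intro continuous_intros)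
  have clamp: "(\<lambda>t. h (c t)) \<in> bcontfun" if "continuous_on {0..T} h" for h :: "real \<Rightarrow> real"
  proof -
    have "range (\<lambda>t. h (c t)) \<subseteq> h ` {0..T}" using c by auto
    moreover have "bounded (h ` {0..T})"
      using that by (intro compact_imp_bounded compact_continuous_image) auto
    ultimately have "bounded (range (\<lambda>t. h (c t)))" by (rule bounded_subset[rotated])
    moreover have "continuous_on UNIV (\<lambda>t. h (c t))"
      by (rule continuous_on_compose2[OF that cont_c]) (use c in auto)
    ultimately show ?thesis by (simp add: bcontfun_def)
  qed
  \<comment> \<open>The Volterra operator conjugated by the weight: the unknown is
    \<open>y t = exp (- L * t) * r t\<close>, measured in the plain supremum norm.\<close>
  define P where "P y t = exp (- L * t) * (g t + integral {0..t} (\<lambda>\<tau>. K t \<tau> * (exp (L * \<tau>) * apply_bcontfun y \<tau>)))"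
    for y t
  have contK: "continuous_on ?D (\<lambda>(t, \<tau>). K t \<tau> * (exp (L * \<tau>) * y \<tau>))"
    if "continuous_on {0..T} y" for y
  proof -
    have "continuous_on ?D (\<lambda>p. (\<lambda>(t, \<tau>). K t \<tau>) p * (exp (L * snd p) * y (snd p)))"
      by (intro continuous_intros K continuous_on_compose2[OF that]) auto
    then show ?thesis by (simp add: case_prod_unfold)
  qed
  have contP: "continuous_on {0..T} (P y)" for y
    unfolding P_def by (intro continuous_intros g continuous_on_integral_triangle contK continuous_on_apply_bcontfun)
  define \<Phi> where "\<Phi> y = Bcontfun (\<lambda>t. P y (c t))" for y
  have \<Phi>: "apply_bcontfun (\<Phi> y) t = P y (c t)" for y t
    unfolding \<Phi>_def by (simp add: Bcontfun_inverse[OF clamp[OF contP]])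
  have contr: "\<bar>P y t - P z t\<bar> \<le> (1/2) * dist y z" if t: "t \<in> {0..T}" for y z t
  proof -
    let ?F = "\<lambda>y \<tau>. K t \<tau> * (exp (L * \<tau>) * apply_bcontfun y \<tau>)"
    have int: "?F y integrable_on {0..t}" for y
      by (rule integrable_on_triangle_slice[OF contK]) (use t in auto)
    have E: "((\<lambda>\<tau>. M * dist y z * exp (L * \<tau>)) has_integral
        (M * dist y z * (exp (L * t) / L) - M * dist y z * (exp (L * 0) / L))) {0..t}"
      by (rule fundamental_theorem_of_calculus)
        (use t L in \<open>auto intro!: derivative_eq_intros simp: has_real_derivative_iff_has_vector_derivative[symmetric]\<close>)
    have "norm (integral {0..t} (\<lambda>\<tau>. ?F y \<tau> - ?F z \<tau>)) \<le> integral {0..t} (\<lambda>\<tau>. M * dist y z * exp (L * \<tau>))"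
    proof (rule integral_norm_bound_integral)
      show "(\<lambda>\<tau>. ?F y \<tau> - ?F z \<tau>) integrable_on {0..t}"
        by (intro integrable_diff int)
      show "(\<lambda>\<tau>. M * dist y z * exp (L * \<tau>)) integrable_on {0..t}"
        using E by blast
      fix \<tau> assume \<tau>: "\<tau> \<in> {0..t}"
      have "?F y \<tau> - ?F z \<tau> = K t \<tau> * (apply_bcontfun y \<tau> - apply_bcontfun z \<tau>) * exp (L * \<tau>)"
        by (simp add: algebra_simps)
      also have "norm \<dots> \<le> M * dist y z * exp (L * \<tau>)"
        using M[of \<tau> t] \<tau> t dist_bounded[of y \<tau> z] \<open>0 < M\<close>
        by (auto simp: abs_mult dist_real_def intro!: mult_right_mono mult_mono)
      finally show "norm (?F y \<tau> - ?F z \<tau>) \<le> M * dist y z * exp (L * \<tau>)" .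
    qed
    also have "\<dots> \<le> M * dist y z * (exp (L * t) / L)"
      using integral_unique[OF E] \<open>0 < M\<close> L by simp
    also have "\<dots> = (1/2) * dist y z * exp (L * t)"
      using \<open>0 < M\<close> by (simp add: L_def)
    finally have "\<bar>integral {0..t} (?F y) - integral {0..t} (?F z)\<bar> \<le> (1/2) * dist y z * exp (L * t)"
      by (simp add: Henstock_Kurzweil_Integration.integral_diff[OF int int])
    then have "exp (- L * t) * \<bar>integral {0..t} (?F y) - integral {0..t} (?F z)\<bar>
        \<le> exp (- L * t) * ((1/2) * dist y z * exp (L * t))"
      by (rule mult_left_mono) simp
    also have "\<dots> = (1/2) * dist y z"
      by (simp add: exp_minus field_simps)
    also have "exp (- L * t) * \<bar>integral {0..t} (?F y) - integral {0..t} (?F z)\<bar> = \<bar>P y t - P z t\<bar>"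
      by (simp add: P_def abs_mult flip: right_diff_distrib)
    finally show ?thesis .
  qed
  have "\<exists>!y. \<Phi> y = y"
  proof (rule banach_fix_type)
    show "\<forall>y z. dist (\<Phi> y) (\<Phi> z) \<le> (1/2) * dist y z"
      by (intro allI dist_bound) (simp add: \<Phi> dist_real_def contr[OF c, simplified])
  qed auto
  then obtain y where y: "\<Phi> y = y" and y_unique: "\<And>z. \<Phi> z = z \<Longrightarrow> z = y" by blast
  define r where "r t = exp (L * t) * apply_bcontfun y t" for t
  have cancel: "exp (L * t) * (exp (- L * t) * x) = x" for t x :: real
    by (simp add: exp_minus)
  have "continuous_on {0..T} r" unfolding r_def by (intro continuous_intros continuous_on_apply_bcontfun)
  moreover have "solves_volterra T g K r"
    unfolding solves_volterra_def
  proof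
    fix t assume t: "t \<in> {0..T}"
    have "apply_bcontfun y t = P y t" using \<Phi>[of y t] by (simp add: y c_id[OF t])
    then show "r t = g t + integral {0..t} (\<lambda>\<tau>. K t \<tau> * r \<tau>)"
      by (simp add: r_def P_def cancel[simplified])
  qed
  moreover have "r' t = r t" if r': "continuous_on {0..T} r'" "solves_volterra T g K r'" and t: "t \<in> {0..T}" for r' t
  proof -
    have cont: "continuous_on {0..T} (\<lambda>t. exp (- L * t) * r' t)"
      by (intro continuous_intros r')
    \<comment> \<open>Any continuous solution, weighted and clamped, is again a fixed point of
      \<Phi>, so uniqueness of the fixed point identifies it with \<open>r\<close>.\<close>
    define z where "z = Bcontfun (\<lambda>t. exp (- L * c t) * r' (c t))"
    have z: "apply_bcontfun z t = exp (- L * c t) * r' (c t)" for t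
      unfolding z_def using Bcontfun_inverse[OF clamp[OF cont]] by simp
    have P_z: "P z t = exp (- L * t) * r' t" if t: "t \<in> {0..T}" for t
    proof -
      have "integral {0..t} (\<lambda>\<tau>. K t \<tau> * (exp (L * \<tau>) * apply_bcontfun z \<tau>)) = integral {0..t} (\<lambda>\<tau>. K t \<tau> * r' \<tau>)"
        by (rule integral_cong) (use t in \<open>simp add: z c_id cancel[simplified]\<close>)
      moreover have "r' t = g t + integral {0..t} (\<lambda>\<tau>. K t \<tau> * r' \<tau>)"
        using r'(2) t by (simp add: solves_volterra_def)
      ultimately show ?thesis by (simp add: P_def)
    qed
    have "\<Phi> z = z"
      by (rule bcontfun_eqI) (use P_z[OF c] in \<open>simp add: \<Phi> z\<close>)
    then have "z = y" by (rule y_unique)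
    then have "apply_bcontfun y t = exp (- L * t) * r' t"
      using z[of t] by (simp add: c_id[OF t])
    then show "r' t = r t" by (simp add: r_def cancel[simplified])
  qed
  ultimately show ?thesis by blast
qed

section \<open>The mild solution in integrated form\<close>

text \<open>Variation of constants for u' = h - a u, u(0) = x0, in integrated form: this is the
  equation satisfied by a single Fourier mode.\<close>

lemma linear_ode_duhamel:
  fixes h :: "real \<Rightarrow> real" and a x0 :: real
  assumes h: "continuous_on {0..T} h" and t: "t \<in> {0..T}"
  defines "u \<equiv> \<lambda>t. exp (- a * t) * x0 + integral {0..t} (\<lambda>\<tau>. exp (- a * (t - \<tau>)) * h \<tau>)"
  shows "((\<lambda>\<rho>. h \<rho> - a * u \<rho>) has_integral u t - x0) {0..t}"
proof -
  let ?J = "\<lambda>t. integral {0..t} (\<lambda>\<tau>. exp (a * \<tau>) * h \<tau>)"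
  \<comment> \<open>Factoring out \<open>exp (- a * t)\<close> leaves \<open>t\<close> only in the
    upper limit of the integral, so the product rule suffices.\<close>
  have u: "u t = exp (- a * t) * (x0 + ?J t)" for t
  proof -
    have "(\<lambda>\<tau>. exp (- a * (t - \<tau>)) * h \<tau>) = (\<lambda>\<tau>. exp (- a * t) * (exp (a * \<tau>) * h \<tau>))"
      by (auto simp: exp_add[symmetric] algebra_simps simp flip: mult.assoc)
    then show ?thesis unfolding u_def by (simp add: distrib_left)
  qed
  have J: "(?J has_real_derivative exp (a * \<rho>) * h \<rho>) (at \<rho> within {0..t})" if "\<rho> \<in> {0..t}" for \<rho>
    by (rule integral_has_real_derivative)
      (use that t in \<open>auto intro!: continuous_intros continuous_on_subset[OF h]\<close>)
  have "(u has_real_derivative h \<rho> - a * u \<rho>) (at \<rho> within {0..t})" if "\<rho> \<in> {0..t}" for \<rho>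
  proof -
    have "((\<lambda>t. exp (- a * t) * (x0 + ?J t)) has_real_derivative
        (exp (- a * \<rho>) * (- a)) * (x0 + ?J \<rho>) + exp (- a * \<rho>) * (exp (a * \<rho>) * h \<rho>)) (at \<rho> within {0..t})"
      by (auto intro!: derivative_eq_intros J[OF that])
    moreover have "(exp (- a * \<rho>) * (- a)) * (x0 + ?J \<rho>) + exp (- a * \<rho>) * (exp (a * \<rho>) * h \<rho>)
        = h \<rho> - a * (exp (- a * \<rho>) * (x0 + ?J \<rho>))"
      by (simp add: exp_minus)
    ultimately show ?thesis
      unfolding u[abs_def] by (simp only:)
  qed
  then have "((\<lambda>\<rho>. h \<rho> - a * u \<rho>) has_integral u t - u 0) {0..t}"
    using t by (intro fundamental_theorem_of_calculus)
      (auto simp: has_real_derivative_iff_has_vector_derivative[symmetric])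
  then show ?thesis by (simp add: u[of 0])
qed

section \<open>Mild solutions for a diagonal generator\<close>

context diagonal_semigroup
begin

lemma continuous_on_convolution_kernel:
  assumes "continuous_on {0..T} h"
  shows "continuous_on {(t, \<tau>). 0 \<le> \<tau> \<and> \<tau> \<le> t \<and> t \<le> T} (\<lambda>(t, \<tau>). semigroup (t - \<tau>) (h \<tau>))"
proof -
  have "continuous_on {(t, \<tau>). 0 \<le> \<tau> \<and> \<tau> \<le> t \<and> t \<le> T} (\<lambda>p. semigroup (fst p - snd p) (h (snd p)))"
    by (intro continuous_on_semigroup continuous_intros continuous_on_compose2[OF assms]) auto
  then show ?thesis by (simp add: case_prod_unfold)
qed

lemma inner_integral_semigroup:
  assumes "continuous_on {0..T} h" "t \<in> {0..T}"
  shows "integral {0..t} (\<lambda>\<tau>. semigroup (t - \<tau>) (h \<tau>)) \<bullet> e k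
    = integral {0..t} (\<lambda>\<tau>. exp (- a k * (t - \<tau>)) * (h \<tau> \<bullet> e k))"
proof -
  have "(\<lambda>\<tau>. semigroup (t - \<tau>) (h \<tau>)) integrable_on {0..t}"
    by (rule integrable_on_triangle_slice[OF continuous_on_convolution_kernel[OF assms(1)]])
      (use assms(2) in simp)
  from integral_linear[OF this bounded_linear_inner_left[of "e k"]]
  have "integral {0..t} (\<lambda>\<tau>. semigroup (t - \<tau>) (h \<tau>)) \<bullet> e k
      = integral {0..t} (\<lambda>\<tau>. semigroup (t - \<tau>) (h \<tau>) \<bullet> e k)"
    by (simp add: comp_def)
  also have "\<dots> = integral {0..t} (\<lambda>\<tau>. exp (- a k * (t - \<tau>)) * (h \<tau> \<bullet> e k))"
    by (rule integral_cong) (simp add: inner_semigroup)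
  finally show ?thesis .
qed

text \<open>Formally \<open>h t - diag a (u t)\<close> for the mild solution \<open>u\<close>. With
  \<open>diag a\<close> already moved onto \<phi> and \<open>h\<close>, continuity follows without
  first placing \<open>u t\<close> in the domain.\<close>

definition mild_velocity :: "'a \<Rightarrow> (real \<Rightarrow> 'a) \<Rightarrow> real \<Rightarrow> 'a" where
  "mild_velocity \<phi> h t = h t - semigroup t (diag a \<phi>)
     - integral {0..t} (\<lambda>\<tau>. semigroup (t - \<tau>) (diag a (h \<tau>)))"

lemma continuous_on_mild_velocity:
  assumes "continuous_on {0..T} h" "continuous_on {0..T} (\<lambda>\<tau>. diag a (h \<tau>))"
  shows "continuous_on {0..T} (mild_velocity \<phi> h)"
  unfolding mild_velocity_def
  by (intro continuous_intros assms continuous_on_semigroup continuous_on_integral_triangle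
      continuous_on_convolution_kernel) auto

theorem mild_solution_eq_integral:
  assumes \<phi>: "\<phi> \<in> dom" "\<phi> \<in> closed_span"
    and h: "continuous_on {0..T} h" "continuous_on {0..T} (\<lambda>\<tau>. diag a (h \<tau>))"
      "\<And>t. t \<in> {0..T} \<Longrightarrow> h t \<in> dom" "\<And>t. t \<in> {0..T} \<Longrightarrow> h t \<in> closed_span"
    and t: "t \<in> {0..T}"
  shows "semigroup t \<phi> + integral {0..t} (\<lambda>\<tau>. semigroup (t - \<tau>) (h \<tau>))
    = \<phi> + integral {0..t} (mild_velocity \<phi> h)"
proof (rule closed_span_eqI)
  have conv_int: "(\<lambda>\<tau>. semigroup (t - \<tau>) (h \<tau>)) integrable_on {0..t}"
    if "continuous_on {0..T} h" "t \<in> {0..T}" for h t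
    by (rule integrable_on_triangle_slice[OF continuous_on_convolution_kernel[OF that(1)]])
      (use that(2) in simp)
  have conv_span: "integral {0..t} (\<lambda>\<tau>. semigroup (t - \<tau>) (h \<tau>)) \<in> closed_span"
    if "continuous_on {0..T} h" "t \<in> {0..T}" for h t
    by (rule closed_span_integral[OF conv_int[OF that]]) (simp add: semigroup_closed_span)
  have vel_int: "mild_velocity \<phi> h integrable_on {0..t}"
    using t by (intro integrable_continuous_real
        continuous_on_subset[OF continuous_on_mild_velocity[OF h(1,2)]]) auto
  show "semigroup t \<phi> + integral {0..t} (\<lambda>\<tau>. semigroup (t - \<tau>) (h \<tau>)) \<in> closed_span"
    using t by (intro closed_span_add semigroup_closed_span conv_span h) auto
  have "mild_velocity \<phi> h \<rho> \<in> closed_span" if "\<rho> \<in> {0..t}" for \<rho>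
    unfolding mild_velocity_def
    using that t by (intro closed_span_diff semigroup_closed_span conv_span h) auto
  then show "\<phi> + integral {0..t} (mild_velocity \<phi> h) \<in> closed_span"
    by (intro closed_span_add \<phi> closed_span_integral[OF vel_int])
  fix k
  \<comment> \<open>The coefficient of the mild solution along \<open>e k\<close>;
    \<open>vel\<close> identifies that of the velocity with the right side of its scalar
    equation.\<close>
  define u where "u t = exp (- a k * t) * (\<phi> \<bullet> e k)
      + integral {0..t} (\<lambda>\<tau>. exp (- a k * (t - \<tau>)) * (h \<tau> \<bullet> e k))" for t
  have hk: "continuous_on {0..T} (\<lambda>\<tau>. h \<tau> \<bullet> e k)"
    by (intro continuous_intros h)
  have a_coeff: "diag a v \<bullet> e k = a k * (v \<bullet> e k)" if "v \<in> dom" for v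
    using that by (simp add: dom_def inner_diag)
  have vel: "mild_velocity \<phi> h \<rho> \<bullet> e k = h \<rho> \<bullet> e k - a k * u \<rho>" if "\<rho> \<in> {0..t}" for \<rho>
  proof -
    have \<rho>: "\<rho> \<in> {0..T}" using that t by auto
    have "integral {0..\<rho>} (\<lambda>\<tau>. exp (- a k * (\<rho> - \<tau>)) * (diag a (h \<tau>) \<bullet> e k))
        = integral {0..\<rho>} (\<lambda>\<tau>. a k * (exp (- a k * (\<rho> - \<tau>)) * (h \<tau> \<bullet> e k)))"
      by (rule integral_cong) (use \<rho> h(3) in \<open>simp add: a_coeff\<close>)
    also have "\<dots> = a k * integral {0..\<rho>} (\<lambda>\<tau>. exp (- a k * (\<rho> - \<tau>)) * (h \<tau> \<bullet> e k))"
      by simp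
    finally show ?thesis
      using \<rho> by (simp add: mild_velocity_def inner_diff_left inner_semigroup a_coeff[OF \<phi>(1)]
          inner_integral_semigroup[OF h(2)] u_def distrib_left)
  qed
  have "integral {0..t} (mild_velocity \<phi> h) \<bullet> e k = integral {0..t} (\<lambda>\<rho>. mild_velocity \<phi> h \<rho> \<bullet> e k)"
    using integral_linear[OF vel_int bounded_linear_inner_left[of "e k"]] by (simp add: comp_def)
  also have "\<dots> = integral {0..t} (\<lambda>\<rho>. h \<rho> \<bullet> e k - a k * u \<rho>)"
    by (rule integral_cong) (rule vel)
  also have "\<dots> = u t - \<phi> \<bullet> e k"
    unfolding u_def by (rule integral_unique[OF linear_ode_duhamel[OF hk t]])
  finally show "(semigroup t \<phi> + integral {0..t} (\<lambda>\<tau>. semigroup (t - \<tau>) (h \<tau>))) \<bullet> e k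
      = (\<phi> + integral {0..t} (mild_velocity \<phi> h)) \<bullet> e k"
    using t by (simp add: inner_add_left inner_semigroup inner_integral_semigroup[OF h(1) t] u_def)
qed

end

section \<open>The sine system in \<open>L2_on l\<close>\<close>

text \<open>Bounded continuous functions reach indicators of open sets by dominated convergence;
  open sets form an intersection-stable generator of the Borel sets, so the integral of
  \<open>h\<close> vanishes over every Borel set.\<close>

lemma AE_eq_0_if_orthogonal_continuous:
  fixes h :: "real \<Rightarrow> real"
  assumes h: "integrable lborel h"
    and orth: "\<And>G. continuous_on UNIV G \<Longrightarrow> (\<And>x. \<bar>G x\<bar> \<le> 1) \<Longrightarrow> (LINT x|lborel. h x * G x) = 0"
  shows "AE x in lborel. h x = 0"
proof -
  have [measurable]: "h \<in> borel_measurable lborel" using h by auto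
  have total: "(LINT x|lborel. h x) = 0"
    using orth[of "\<lambda>x. 1"] by simp
  have open_0: "(LINT x:U|lborel. h x) = 0" if "open U" for U
  \<comment> \<open>\<open>infdist\<close> to the empty set is 0 by convention, so the functions
    \<open>G n\<close> below would vanish for \<open>U = UNIV\<close>; that case is the total
    integral.\<close>
  proof (cases "U = UNIV")
    case False
    define G where "G n x = min 1 (real n * infdist x (- U))" for n x
    have G: "continuous_on UNIV (G n)" "0 \<le> G n x" "G n x \<le> 1" for n x
      unfolding G_def by (auto intro!: continuous_intros mult_nonneg_nonneg infdist_nonneg)
    have [measurable]: "G n \<in> borel_measurable borel" for n
      using G(1) by (rule borel_measurable_continuous_onI)
    have lim: "(\<lambda>n. G n x) \<longlonglongrightarrow> indicator U x" for x
    proof (cases "x \<in> U")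
      case True
      then have "infdist x (- U) \<noteq> 0"
        using in_closed_iff_infdist_zero[of "- U" x] \<open>open U\<close> False by auto
      then have pos: "0 < infdist x (- U)" using infdist_nonneg[of x "- U"] by linarith
      obtain N :: nat where N: "1 / infdist x (- U) < N" using reals_Archimedean2 by blast
      have "G n x = 1" if "n \<ge> N" for n
      proof -
        have "1 / infdist x (- U) \<le> real n" using N that by linarith
        then show ?thesis using pos by (simp add: G_def field_simps min_def)
      qed
      then have "\<forall>\<^sub>F n in sequentially. G n x = 1" by (auto simp: eventually_sequentially)
      then show ?thesis using True by (simp add: tendsto_eventually)
    next
      case False
      then show ?thesis by (simp add: G_def)
    qed
    have "(\<lambda>n. LINT x|lborel. h x * G n x) \<longlonglongrightarrow> (LINT x|lborel. h x * indicator U x)"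
    proof (rule integral_dominated_convergence[where w = "\<lambda>x. \<bar>h x\<bar>"])
      show "AE x in lborel. (\<lambda>n. h x * G n x) \<longlonglongrightarrow> h x * indicator U x"
        by (intro always_eventually allI tendsto_mult_left lim)
      show "AE x in lborel. norm (h x * G n x) \<le> \<bar>h x\<bar>" for n
        using G by (intro always_eventually allI) (simp add: abs_mult mult_left_le)
      show "(\<lambda>x. h x * indicator U x) \<in> borel_measurable lborel"
        using borel_open[OF \<open>open U\<close>] by measurable
    qed (use h in simp_all)
    moreover have "(LINT x|lborel. h x * G n x) = 0" for n
      using G by (intro orth) auto
    ultimately have "(LINT x|lborel. h x * indicator U x) = 0"
      by (simp add: LIMSEQ_const_iff)
    then show ?thesis by (simp add: set_lebesgue_integral_def mult.commute)
  qed (simp add: total set_lebesgue_integral_def)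
  have "AE x in lborel. h x = (\<lambda>x. 0) x"
  proof (rule density_unique_real[OF h])
    fix A :: "real set" assume "A \<in> sets lborel"
    then have A: "A \<in> sigma_sets UNIV {S. open S}" by (simp add: borel_def)
    have "Int_stable {S::real set. open S}" "{S::real set. open S} \<subseteq> Pow UNIV"
      by (auto simp: Int_stable_def)
    from this A have "A \<in> sets borel \<and> (LINT x:A|lborel. h x) = 0"
    proof (induction rule: sigma_sets_induct_disjoint)
      case (basic A)
      then show ?case by (auto simp: open_0)
    next
      case empty
      then show ?case by (simp add: set_lebesgue_integral_def)
    next
      case (compl A)
      have "set_integrable lborel B h" if "B \<in> sets borel" for B
        unfolding set_integrable_def using integrable_mult_indicator[OF _ h] that by auto
      then have "(LINT x:A \<union> (UNIV - A)|lborel. h x) = (LINT x:A|lborel. h x) + (LINT x:UNIV - A|lborel. h x)"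
        using compl.IH by (intro set_integral_Un) auto
      moreover have "UNIV - A \<in> sets borel"
        using compl.IH sets.compl_sets[of A borel] by simp
      ultimately show ?case
        using compl.IH open_0[of UNIV] by simp
    next
      case (union A)
      then have m: "A i \<in> sets lborel" for i by simp
      have "set_integrable lborel (\<Union>i. A i) h"
        unfolding set_integrable_def using integrable_mult_indicator[OF _ h] m by auto
      then have "(LINT x:(\<Union>i. A i)|lborel. h x) = (\<Sum>i. LINT x:A i|lborel. h x)"
        using union.hyps m by (intro lebesgue_integral_countable_add) (auto simp: disjoint_family_on_def)
      then show ?case using union.IH by auto
    qed
    then show "(LINT x:A|lborel. h x) = (LINT x:A|lborel. 0)" by simp
  qed simp
  then show ?thesis by simp
qed

section \<open>Orthonormality and totality of the sines\<close>

lemma integral_cos_multiple: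
  fixes m :: int
  assumes "0 < l"
  shows "has_bochner_integral lborel (\<lambda>x. cos (of_int m * pi * x / l) * indicator {0..l} x)
    (if m = 0 then l else 0)"
proof (cases "m = 0")
  case True
  have "has_bochner_integral lborel (\<lambda>x. 1 * indicator {0..l} x) (l - 0)"
    using assms by (intro has_bochner_integral_FTC_Icc_real) (auto intro!: derivative_eq_intros)
  then show ?thesis using True by simp
next
  case False
  let ?F = "\<lambda>x. l / (of_int m * pi) * sin (of_int m * pi * x / l)"
  have "has_bochner_integral lborel (\<lambda>x. cos (of_int m * pi * x / l) * indicator {0..l} x) (?F l - ?F 0)"
    using assms False
    by (intro has_bochner_integral_FTC_Icc_real) (auto intro!: derivative_eq_intros continuous_intros)
  moreover have "sin (of_int m * pi * l / l) = 0"
    using assms sin_npi_int[of m] by (simp add: mult.commute)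
  ultimately show ?thesis using False by simp
qed

text \<open>The product of two sines is half a difference of cosines with frequencies i - j and i +
  j + 2. The second is never 0, the first only for i = j.\<close>

lemma inner_eigenfun:
  assumes "0 < l"
  shows "eigenfun l (Suc i) \<bullet> eigenfun l (Suc j) = (if i = j then 1 else 0)"
proof -
  let ?s = "\<lambda>k x. sin (real k * pi * x / l)"
  let ?c = "\<lambda>m x. cos (of_int m * pi * x / l) * indicator {0..l} x"
  have "eigenfun l (Suc i) \<bullet> eigenfun l (Suc j)
      = (LINT x|lborel. (indicator {0<..<l} x * (sqrt (2 / l) * ?s (Suc i) x)) *
          (indicator {0<..<l} x * (sqrt (2 / l) * ?s (Suc j) x)))"
    by transfer simp
  also have "\<dots> = (LINT x|lborel. (1 / l) * (?c (int i - int j) x - ?c (int i + int j + 2) x))"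
  proof (rule Bochner_Integration.integral_cong[OF refl])
    fix x
    \<comment> \<open>\<open>eigenfun\<close> carries the indicator of the open interval,
      \<open>?c\<close> that of the closed one; the integrands still agree at the end points because
      the sines vanish there.\<close>
    have end0: "sin ((1 + real k) * pi) = 0" for k
      using sin_npi[of "Suc k"] unfolding of_nat_Suc .
    have prod: "?s (Suc i) x * ?s (Suc j) x
        = (cos (of_int (int i - int j) * pi * x / l) - cos (of_int (int i + int j + 2) * pi * x / l)) / 2"
      by (simp add: sin_times_sin algebra_simps add_divide_distrib diff_divide_distrib)
    have norm: "sqrt (2 / l) * sqrt (2 / l) = 2 / l" using assms by simp
    show "(indicator {0<..<l} x * (sqrt (2 / l) * ?s (Suc i) x)) *
          (indicator {0<..<l} x * (sqrt (2 / l) * ?s (Suc j) x))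
        = (1 / l) * (?c (int i - int j) x - ?c (int i + int j + 2) x)"
    proof (cases "x \<in> {0<..<l}")
      case True
      then have "(indicator {0<..<l} x * (sqrt (2 / l) * ?s (Suc i) x)) *
          (indicator {0<..<l} x * (sqrt (2 / l) * ?s (Suc j) x))
        = (sqrt (2 / l) * sqrt (2 / l)) * (?s (Suc i) x * ?s (Suc j) x)"
        by (simp only: indicator_simps mult_1_left mult_ac)
      also have "\<dots> = (1 / l) * (?c (int i - int j) x - ?c (int i + int j + 2) x)"
      proof -
        have "x \<in> {0..l}" using True by auto
        moreover have "2 / l * ((p - q) / 2) = 1 / l * (p - q)" for p q
          using assms by (simp add: field_simps)
        ultimately show ?thesis unfolding prod norm by (simp only: indicator_simps mult_1_right)
      qed
      finally show ?thesis .
    next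
      case False
      have "?s (Suc i) x * ?s (Suc j) x = 0" if "x = 0 \<or> x = l"
        using that assms end0[of i] by auto
      with False prod show ?thesis
        by (cases "x = 0 \<or> x = l") (auto simp: indicator_def)
    qed
  qed
  also have "\<dots> = (1 / l) * ((if int i - int j = 0 then l else 0) - (if int i + int j + 2 = 0 then l else 0))"
    by (intro has_bochner_integral_integral_eq has_bochner_integral_mult_right
        has_bochner_integral_diff integral_cos_multiple assms)
  also have "\<dots> = (if i = j then 1 else 0)"
    using assms by auto
  finally show ?thesis .
qed

text \<open>By \<open>2 sin a cos b = sin (a + b) + sin (a - b)\<close>, the function \<open>f sin (\<pi> x / l)\<close> is orthogonal
  to all powers of \<open>cos (\<pi> x / l)\<close>, which is injective on \<open>[0, l]\<close>; Weierstrass approximation in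
  this variable then reaches every continuous function.\<close>

lemma sine_system_total:
  fixes f :: "real \<Rightarrow> real"
  assumes l: "0 < l" and f: "integrable lborel (\<lambda>x. indicator {0<..<l} x * f x)"
    and orth: "\<And>k. (LINT x|lborel. indicator {0<..<l} x * f x * sin (real k * pi * x / l)) = 0"
  shows "AE x in lborel. x \<in> {0<..<l} \<longrightarrow> f x = 0"
proof -
  let ?f = "\<lambda>x. indicator {0<..<l} x * f x"
  let ?s = "\<lambda>k x. sin (real k * pi * x / l)" and ?c = "\<lambda>x. cos (pi * x / l)"
  \<comment> \<open>The factor \<open>sin (pi * x / l)\<close> is positive inside the interval, so
    it can be divided out at the end.\<close>
  define h where "h x = ?f x * sin (pi * x / l)" for x
  have [measurable]: "?f \<in> borel_measurable lborel" using f by auto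
  have int: "integrable lborel (\<lambda>x. ?f x * (?s k x * ?c x ^ n))" for k n
  proof (rule Bochner_Integration.integrable_bound[OF f])
    have "\<bar>?s k x * ?c x ^ n\<bar> \<le> 1" for x
      by (simp add: abs_mult power_abs mult_le_one power_le_one)
    then show "AE x in lborel. norm (?f x * (?s k x * ?c x ^ n)) \<le> norm (?f x)"
      by (intro always_eventually allI) (simp add: abs_mult mult_left_le)
  qed measurable
  \<comment> \<open>The mode \<open>k\<close> is generalised because each cosine factor replaces it
    by its two neighbours; the descent may end at \<open>k = 0\<close>, where the sine is 0.\<close>
  have moments: "(LINT x|lborel. ?f x * (?s k x * ?c x ^ n)) = 0" for k n
  proof (induction n arbitrary: k)
    case 0
    then show ?case using orth[of k] by simp
  next
    case (Suc n)
    show ?case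
    proof (cases k)
      case (Suc j)
      have split: "?s k x * ?c x = (?s (Suc k) x + ?s j x) / 2" for x
      proof -
        have "real (Suc k) * pi * x / l = real k * pi * x / l + pi * x / l"
          "real j * pi * x / l = real k * pi * x / l - pi * x / l"
          by (simp_all add: Suc algebra_simps add_divide_distrib)
        then show ?thesis by (simp only: sin_times_cos)
      qed
      have "(LINT x|lborel. ?f x * (?s k x * ?c x ^ Suc n))
        = (LINT x|lborel. (1/2) * (?f x * (?s (Suc k) x * ?c x ^ n) + ?f x * (?s j x * ?c x ^ n)))"
      proof (rule Bochner_Integration.integral_cong[OF refl])
        fix x
        have "?f x * (?s k x * ?c x ^ Suc n) = ?f x * ((?s k x * ?c x) * ?c x ^ n)"
          by (simp only: power_Suc mult.assoc)
        then show "?f x * (?s k x * ?c x ^ Suc n)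
            = (1/2) * (?f x * (?s (Suc k) x * ?c x ^ n) + ?f x * (?s j x * ?c x ^ n))"
          unfolding split by (simp add: algebra_simps add_divide_distrib)
      qed
      also have "\<dots> = 0"
        by (subst integral_mult_right_zero,
            subst Bochner_Integration.integral_add[OF int int]) (simp only: Suc.IH add_0 mult_zero_right)
      finally show ?thesis .
    qed simp
  qed
  have h: "integrable lborel h" using int[of 1 0] by (simp add: h_def[abs_def])
  have hpow: "integrable lborel (\<lambda>x. h x * ?c x ^ n)" "(LINT x|lborel. h x * ?c x ^ n) = 0" for n
    using int[of 1 n] moments[of 1 n] by (simp_all add: h_def mult.assoc)
  have "AE x in lborel. h x = 0"
  proof (rule AE_eq_0_if_orthogonal_continuous[OF h])
    fix G :: "real \<Rightarrow> real"
    assume G: "continuous_on UNIV G" "\<And>x. \<bar>G x\<bar> \<le> 1"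
    have [measurable]: "G \<in> borel_measurable borel"
      using G(1) by (rule borel_measurable_continuous_onI)
    have hG: "integrable lborel (\<lambda>x. h x * G x)"
      by (rule Bochner_Integration.integrable_bound[OF h])
        (use h G(2) in \<open>auto simp: abs_mult mult_left_le\<close>)
    have bound: "\<bar>LINT x|lborel. h x * G x\<bar> \<le> \<epsilon> * (LINT x|lborel. \<bar>h x\<bar>)" if "0 < \<epsilon>" for \<epsilon>
    proof -
      have cont: "continuous_on {-1..1} (\<lambda>y. G (l / pi * arccos y))"
        by (intro continuous_on_compose2[OF G(1)] continuous_intros) auto
      obtain p where p: "real_polynomial_function p"
        and approx: "\<And>y. y \<in> {-1..1} \<Longrightarrow> \<bar>G (l / pi * arccos y) - p y\<bar> < \<epsilon>"
        using Stone_Weierstrass_real_polynomial_function[OF _ cont \<open>0 < \<epsilon>\<close>] by auto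
      obtain b n where p_eq: "p = (\<lambda>y. \<Sum>i\<le>n. b i * y ^ i)"
        using p unfolding real_polynomial_function_iff_sum by blast
      have hp_eq: "h x * p (?c x) = (\<Sum>i\<le>n. b i * (h x * ?c x ^ i))" for x
        by (simp add: p_eq sum_distrib_left mult.left_commute)
      have hp: "integrable lborel (\<lambda>x. h x * p (?c x))" "(LINT x|lborel. h x * p (?c x)) = 0"
        unfolding hp_eq by (simp_all add: hpow Bochner_Integration.integral_sum)
      have "\<bar>LINT x|lborel. h x * G x\<bar> = \<bar>LINT x|lborel. h x * G x - h x * p (?c x)\<bar>"
        by (simp add: Bochner_Integration.integral_diff[OF hG hp(1)] hp(2))
      also have "\<dots> \<le> (LINT x|lborel. \<bar>h x * G x - h x * p (?c x)\<bar>)"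
        by (rule integral_abs_bound)
      also have "\<dots> \<le> (LINT x|lborel. \<epsilon> * \<bar>h x\<bar>)"
      proof (rule integral_mono)
        fix x
        show "\<bar>h x * G x - h x * p (?c x)\<bar> \<le> \<epsilon> * \<bar>h x\<bar>"
        proof (cases "x \<in> {0<..<l}")
          case True
          then have "pi * x / l \<le> pi" "0 \<le> pi * x / l" using l by (simp_all add: field_simps)
          then have "l / pi * arccos (?c x) = x" using l by (simp add: arccos_cos)
          then have "\<bar>G x - p (?c x)\<bar> \<le> \<epsilon>"
            using approx[of "?c x"] by simp
          then have "\<bar>h x\<bar> * \<bar>G x - p (?c x)\<bar> \<le> \<bar>h x\<bar> * \<epsilon>" by (rule mult_left_mono) simp
          then show ?thesis
            by (simp only: abs_mult[symmetric] right_diff_distrib mult.commute[of _ \<epsilon>])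
        qed (simp add: h_def)
      qed (use hG hp(1) h in simp_all)
      finally show ?thesis by simp
    qed
    show "(LINT x|lborel. h x * G x) = 0"
    proof (rule ccontr)
      define B where "B = (LINT x|lborel. \<bar>h x\<bar>)"
      define I where "I = \<bar>LINT x|lborel. h x * G x\<bar>"
      assume "(LINT x|lborel. h x * G x) \<noteq> 0"
      then have pos: "0 < I" by (simp add: I_def)
      have B: "0 \<le> B" by (simp add: B_def)
      \<comment> \<open>\<open>bound\<close> is used with this quotient as \<epsilon>; the 1 added
        to \<open>B\<close> keeps it meaningful when \<open>B = 0\<close>.\<close>
      have "I \<le> I / (2 * (B + 1)) * B"
        using bound[of "I / (2 * (B + 1))"] pos B by (simp add: I_def[symmetric] B_def[symmetric])
      also have "\<dots> < I"
        using pos B by (simp add: field_simps add_nonneg_pos)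
      finally show False by simp
    qed
  qed
  then show ?thesis
  proof eventually_elim
    case (elim x)
    show ?case
    proof
      assume x: "x \<in> {0<..<l}"
      then have "0 < sin (pi * x / l)"
        using l by (intro sin_gt_zero) (simp_all add: field_simps)
      then show "f x = 0" using elim x by (simp add: h_def)
    qed
  qed
qed

lemma orthonormal_eigenfun: "0 < l \<Longrightarrow> orthonormal_sequence (\<lambda>k. eigenfun l (Suc k))"
  by unfold_locales (rule inner_eigenfun)

text \<open>This places \<open>L2_on l\<close> inside \<open>closed_span\<close>. Here
  \<open>y\<close> ranges over all of \<open>L2\<close>: the eigenfunctions see only its restriction
  to (0,l), which totality makes zero, and \<open>v\<close> lives only there.\<close>

lemma inner_eq_0_if_orthogonal_eigenfun:
  assumes l: "0 < l" and v: "v \<in> L2_on l" and y: "\<And>k. y \<bullet> eigenfun l (Suc k) = 0"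
  shows "v \<bullet> y = 0"
  using v y unfolding L2_on_def mem_Collect_eq
proof (transfer fixing: l)
  fix v y :: "real \<Rightarrow> real"
  assume v: "square_integrable v \<and> square_integrable v \<and> (AE x in lborel. v x = v x)"
    and y: "square_integrable y \<and> square_integrable y \<and> (AE x in lborel. y x = y x)"
    and v0: "AE x in lborel. x \<notin> {0<..<l} \<longrightarrow> v x = 0"
    and orth: "\<And>k. (LINT x|lborel. y x * (indicator {0<..<l} x * (sqrt (2 / l) * sin (real (Suc k) * pi * x / l)))) = 0"
  have ind: "square_integrable (indicat_real {0<..<l})"
    using l by (simp add: square_integrable_def power2_eq_square flip: indicator_inter_arith)
  have "AE x in lborel. x \<in> {0<..<l} \<longrightarrow> y x = 0"
  proof (rule sine_system_total[OF l])
    show "integrable lborel (\<lambda>x. indicat_real {0<..<l} x * y x)"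
      using y ind by (intro square_integrable_mult) auto
    fix k
    \<comment> \<open>The totality lemma counts frequencies from 0, the eigenfunctions from 1;
      frequency 0 contributes the zero function.\<close>
    show "(LINT x|lborel. indicator {0<..<l} x * y x * sin (real k * pi * x / l)) = 0"
    proof (cases k)
      case (Suc j)
      have "(LINT x|lborel. sqrt (2 / l) * (indicator {0<..<l} x * y x * sin (real k * pi * x / l))) = 0"
        using orth[of j] by (simp add: Suc mult_ac)
      then show ?thesis using l by simp
    qed simp
  qed
  with v0 have "AE x in lborel. v x * y x = 0"
    by eventually_elim auto
  then show "(LINT x|lborel. v x * y x) = 0"
    by (rule integral_eq_zero_AE)
qed

section \<open>The inverse source problem\<close>

text \<open>\<open>D\<close> is the derivative of its primitive, which is constantly 0. Since
  \<open>0 < T\<close>, the derivative within [0,T] is unique even at the end points.\<close>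

lemma eq_0_if_integral_eq_0:
  fixes D :: "real \<Rightarrow> real"
  assumes "0 < T" and D: "continuous_on {0..T} D"
    and zero: "\<And>t. t \<in> {0..T} \<Longrightarrow> integral {0..t} D = 0" and t: "t \<in> {0..T}"
  shows "D t = 0"
proof -
  have "((\<lambda>t. integral {0..t} D) has_vector_derivative D t) (at t within {0..T})"
    by (rule integral_has_vector_derivative[OF D t])
  moreover have "((\<lambda>t. integral {0..t} D) has_vector_derivative 0) (at t within {0..T})"
    by (rule has_vector_derivative_transform[OF t _ has_vector_derivative_const[of 0]]) (simp add: zero)
  ultimately show ?thesis
    using vector_derivative_unique_within_closed_interval[of 0 T t] assms(1) t by simp
qed

text \<open>The graph norm dominates both of its components. Additivity of \<open>A\<close> is asked
  only on values of \<open>f\<close>, since \<open>diag a\<close> is known to split over differences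
  only within \<open>dom\<close>.\<close>

lemma continuous_on_if_graph_norm_continuous:
  fixes A :: "'a::real_normed_vector \<Rightarrow> 'b::real_normed_vector"
  assumes lim: "\<And>t. t \<in> S \<Longrightarrow> ((\<lambda>t'. sqrt ((norm (f t' - f t))\<^sup>2 + (norm (A (f t' - f t)))\<^sup>2)) \<longlongrightarrow> 0) (at t within S)"
    and A: "\<And>t t'. t \<in> S \<Longrightarrow> t' \<in> S \<Longrightarrow> A (f t' - f t) = A (f t') - A (f t)"
  shows "continuous_on S f" "continuous_on S (\<lambda>t. A (f t))"
proof -
  show "continuous_on S f" unfolding continuous_on_def
  proof
    fix t assume "t \<in> S"
    have "((\<lambda>t'. f t' - f t) \<longlongrightarrow> 0) (at t within S)"
      by (rule Lim_null_comparison[OF _ lim[OF \<open>t \<in> S\<close>]])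
        (intro always_eventually allI real_sqrt_sum_squares_ge1)
    then show "(f \<longlongrightarrow> f t) (at t within S)" by (rule LIM_zero_cancel)
  qed
  show "continuous_on S (\<lambda>t. A (f t))" unfolding continuous_on_def
  proof
    fix t assume "t \<in> S"
    have "((\<lambda>t'. A (f t') - A (f t)) \<longlongrightarrow> 0) (at t within S)"
      by (rule Lim_null_comparison[OF _ lim[OF \<open>t \<in> S\<close>]], unfold eventually_at_filter,
          intro always_eventually allI impI, subst A[symmetric])
        (use \<open>t \<in> S\<close> in \<open>simp_all add: real_sqrt_sum_squares_ge2\<close>)
    then show "((\<lambda>t. A (f t)) \<longlongrightarrow> A (f t)) (at t within S)" by (rule LIM_zero_cancel)
  qed
qed

theorem mainTheorem5:
  fixes l T s \<kappa>\<^sub>0 :: real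
    and \<phi> \<omega> :: L2
    and f :: "real \<Rightarrow> L2"
    and w w' :: "real \<Rightarrow> real"
  assumes "0 < l" and "0 < T" and "0 < s" and "s < 1"
    and "\<phi> \<in> frac_dom l s"
    and "continuous_into_dom l s {0..T} f"
    and "\<omega> \<in> L2_on l"
    and "\<forall>t\<in>{0..T}. (w has_real_derivative w' t) (at t within {0..T})"
    and "continuous_on {0..T} w'"
    and "w 0 = \<phi> \<bullet> \<omega>"
    and "0 < \<kappa>\<^sub>0" and "\<forall>t\<in>{0..T}. \<kappa>\<^sub>0 \<le> \<bar>f t \<bullet> \<omega>\<bar>"
  shows "let g = volterra_rhs l s \<phi> f \<omega> w'; K = volterra_kernel l s f \<omega> in
    (\<forall>r. continuous_on {0..T} r \<longrightarrow>
        (\<forall>t\<in>{0..T}. mild_solution l s \<phi> f r t \<bullet> \<omega> = w t) \<longrightarrow> solves_volterra T g K r) \<and>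
    (\<exists>r. continuous_on {0..T} r \<and> solves_volterra T g K r \<and>
        (\<forall>r'. continuous_on {0..T} r' \<longrightarrow> solves_volterra T g K r' \<longrightarrow> (\<forall>t\<in>{0..T}. r' t = r t))) \<and>
    (\<forall>r. continuous_on {0..T} r \<longrightarrow> solves_volterra T g K r \<longrightarrow>
        (\<forall>t\<in>{0..T}. mild_solution l s \<phi> f r t \<bullet> \<omega> = w t))"
proof -
  define e where "e k = eigenfun l (Suc k)" for k
  define a where "a k = eigenvalue l (Suc k) powr s" for k
  interpret orthonormal_sequence e
    unfolding e_def by (rule orthonormal_eigenfun[OF \<open>0 < l\<close>])
  interpret diagonal_semigroup e a
    by unfold_locales (simp add: a_def)
  have lap: "frac_lap l s = diag a"
    by (simp add: fun_eq_iff frac_lap_def diag_def a_def e_def)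
  have sg: "frac_semigroup l s t = semigroup t" for t
    by (simp add: fun_eq_iff frac_semigroup_def semigroup_def diag_def a_def e_def)
  \<comment> \<open>The weight with exponent \<open>2 * s\<close> is the square of
    \<open>a k\<close>, which gives \<open>dom\<close>; support in (0,l) becomes
    \<open>closed_span\<close> through totality of the sines.\<close>
  have frac_domD: "v \<in> dom" "v \<in> closed_span" if v: "v \<in> frac_dom l s" for v
  proof -
    have "eigenvalue l (Suc k) powr (2 * s) * \<bar>v \<bullet> eigenfun l (Suc k)\<bar>\<^sup>2 = (a k * (v \<bullet> e k))\<^sup>2" for k
    proof -
      have "eigenvalue l (Suc k) powr (2 * s) = (a k)\<^sup>2"
        by (simp add: a_def power2_eq_square flip: powr_add)
      then show ?thesis by (simp add: e_def power_mult_distrib)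
    qed
    then show "v \<in> dom" using v by (simp add: dom_def frac_dom_def)
    show "v \<in> closed_span"
      using v inner_eq_0_if_orthogonal_eigenfun[OF \<open>0 < l\<close>]
      by (auto simp: closed_span_def frac_dom_def e_def)
  qed
  note \<phi> = frac_domD[OF \<open>\<phi> \<in> frac_dom l s\<close>]
  have f: "f t \<in> dom" "f t \<in> closed_span" if "t \<in> {0..T}" for t
    using \<open>continuous_into_dom l s {0..T} f\<close> that frac_domD[of "f t"]
    by (simp_all add: continuous_into_dom_def)
  have f_cont: "continuous_on {0..T} f" "continuous_on {0..T} (\<lambda>t. diag a (f t))"
  proof -
    have lim: "((\<lambda>t'. sqrt ((norm (f t' - f t))\<^sup>2 + (norm (diag a (f t' - f t)))\<^sup>2)) \<longlongrightarrow> 0) (at t within {0..T})"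
      if "t \<in> {0..T}" for t
      using \<open>continuous_into_dom l s {0..T} f\<close> that
      by (simp add: continuous_into_dom_def graph_norm_def lap)
    show "continuous_on {0..T} f" "continuous_on {0..T} (\<lambda>t. diag a (f t))"
      using continuous_on_if_graph_norm_continuous[of "{0..T}" f "diag a", OF lim diag_diff_dom[OF f(1) f(1)]]
      by blast+
  qed
  have nz: "f t \<bullet> \<omega> \<noteq> 0" if "t \<in> {0..T}" for t
  proof -
    have "\<kappa>\<^sub>0 \<le> \<bar>f t \<bullet> \<omega>\<bar>" using assms(12) that by blast
    then show ?thesis using assms(11) by auto
  qed
  define g where "g = volterra_rhs l s \<phi> f \<omega> w'"
  define K where "K = volterra_kernel l s f \<omega>"
  \<comment> \<open>From here on \<open>g\<close> and \<open>K\<close> are used with the operator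
    inside the semigroup, the form in which their continuity is visible. The rewriting is valid only
    for nonnegative times, hence on the triangle for \<open>K\<close>.\<close>
  have g: "g t = (w' t + semigroup t (diag a \<phi>) \<bullet> \<omega>) / (f t \<bullet> \<omega>)" if "0 \<le> t" for t
    unfolding g_def volterra_rhs_def lap sg by (simp add: diag_semigroup_commute[OF \<phi>(1) that])
  have K: "K t \<tau> = (semigroup (t - \<tau>) (diag a (f \<tau>)) \<bullet> \<omega>) / (f t \<bullet> \<omega>)"
    if "0 \<le> \<tau>" "\<tau> \<le> t" "t \<le> T" for t \<tau>
    unfolding K_def volterra_kernel_def lap sg using that
    by (simp add: diag_semigroup_commute f)
  have cont_g: "continuous_on {0..T} g"
  proof (rule continuous_on_eq)
    show "continuous_on {0..T} (\<lambda>t. (w' t + semigroup t (diag a \<phi>) \<bullet> \<omega>) / (f t \<bullet> \<omega>))"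
      using nz by (intro continuous_intros continuous_on_semigroup f_cont assms(9)) auto
  qed (simp add: g)
  have cont_K: "continuous_on {(t, \<tau>). 0 \<le> \<tau> \<and> \<tau> \<le> t \<and> t \<le> T} (\<lambda>(t, \<tau>). K t \<tau>)"
  proof (rule continuous_on_eq)
    show "continuous_on {(t, \<tau>). 0 \<le> \<tau> \<and> \<tau> \<le> t \<and> t \<le> T}
        (\<lambda>p. ((\<lambda>(t, \<tau>). semigroup (t - \<tau>) (diag a (f \<tau>))) p \<bullet> \<omega>) / (f (fst p) \<bullet> \<omega>))"
      using nz by (intro continuous_intros continuous_on_convolution_kernel f_cont(2)
          continuous_on_compose2[OF f_cont(1)]) auto
  qed (auto simp: K)
  \<comment> \<open>The rate of change of the mismatch between the observation of the mild solution
    and \<open>w\<close>.\<close>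
  define V where "V r t = mild_velocity \<phi> (\<lambda>\<tau>. r \<tau> *\<^sub>R f \<tau>) t \<bullet> \<omega> - w' t" for r t
  have V_eq: "V r t = (f t \<bullet> \<omega>) * (r t - g t - integral {0..t} (\<lambda>\<tau>. K t \<tau> * r \<tau>))"
    and V_cont: "continuous_on {0..T} (V r)"
    and V_int: "mild_solution l s \<phi> f r t \<bullet> \<omega> = w t + integral {0..t} (V r)"
    if r: "continuous_on {0..T} r" and t: "t \<in> {0..T}" for r t
  proof -
    define h where "h \<tau> = r \<tau> *\<^sub>R f \<tau>" for \<tau>
    have diag_h: "diag a (h \<tau>) = r \<tau> *\<^sub>R diag a (f \<tau>)" if "\<tau> \<in> {0..T}" for \<tau>
      using f(1)[OF that] by (simp add: h_def dom_def diag_scaleR)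
    have h: "continuous_on {0..T} h" "continuous_on {0..T} (\<lambda>\<tau>. diag a (h \<tau>))"
    proof -
      show "continuous_on {0..T} h" unfolding h_def by (intro continuous_intros r f_cont)
      have "continuous_on {0..T} (\<lambda>\<tau>. r \<tau> *\<^sub>R diag a (f \<tau>))" by (intro continuous_intros r f_cont)
      then show "continuous_on {0..T} (\<lambda>\<tau>. diag a (h \<tau>))"
        by (rule continuous_on_eq) (simp add: diag_h)
    qed
    have h_dom: "h t \<in> dom" "h t \<in> closed_span" if "t \<in> {0..T}" for t
      using f[OF that] by (simp_all add: h_def closed_span_scaleR dom_scaleR)
    note vel_cont = continuous_on_mild_velocity[OF h, of \<phi>]
    show V_cont: "continuous_on {0..T} (V r)"
      unfolding V_def h_def[symmetric] by (intro continuous_intros vel_cont assms(9))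
    show "V r t = (f t \<bullet> \<omega>) * (r t - g t - integral {0..t} (\<lambda>\<tau>. K t \<tau> * r \<tau>))"
    proof -
      have "(\<lambda>\<tau>. semigroup (t - \<tau>) (diag a (h \<tau>))) integrable_on {0..t}"
        by (rule integrable_on_triangle_slice[OF continuous_on_convolution_kernel[OF h(2)]]) (use t in simp)
      from integral_linear[OF this bounded_linear_inner_left[of \<omega>]]
      have "integral {0..t} (\<lambda>\<tau>. semigroup (t - \<tau>) (diag a (h \<tau>))) \<bullet> \<omega>
          = integral {0..t} (\<lambda>\<tau>. semigroup (t - \<tau>) (diag a (h \<tau>)) \<bullet> \<omega>)"
        by (simp add: comp_def)
      \<comment> \<open>The denominator of the kernel depends on \<open>t\<close> alone, so it
        cancels against a factor that leaves the integral.\<close>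
      also have "\<dots> = integral {0..t} (\<lambda>\<tau>. (f t \<bullet> \<omega>) * (K t \<tau> * r \<tau>))"
        by (rule integral_cong) (use t nz[OF t] in \<open>simp add: diag_h semigroup_scaleR K\<close>)
      also have "\<dots> = (f t \<bullet> \<omega>) * integral {0..t} (\<lambda>\<tau>. K t \<tau> * r \<tau>)" by simp
      finally show ?thesis
        unfolding V_def h_def[symmetric] mild_velocity_def using t nz[OF t]
        by (simp add: inner_diff_left g h_def right_diff_distrib)
    qed
    show "mild_solution l s \<phi> f r t \<bullet> \<omega> = w t + integral {0..t} (V r)"
    proof -
      have sub: "{0..t} \<subseteq> {0..T}" using t by auto
      have vel_int: "mild_velocity \<phi> h integrable_on {0..t}"
        by (intro integrable_continuous_real continuous_on_subset[OF vel_cont sub])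
      have w_int: "(w' has_integral w t - w 0) {0..t}"
      proof (rule fundamental_theorem_of_calculus)
        fix \<rho> assume "\<rho> \<in> {0..t}"
        then have "(w has_vector_derivative w' \<rho>) (at \<rho> within {0..T})"
          using bspec[OF assms(8), of \<rho>] sub
          by (auto simp: has_real_derivative_iff_has_vector_derivative)
        then show "(w has_vector_derivative w' \<rho>) (at \<rho> within {0..t})"
          by (rule has_vector_derivative_within_subset[OF _ sub])
      qed (use t in simp)
      have "mild_solution l s \<phi> f r t = \<phi> + integral {0..t} (mild_velocity \<phi> h)"
        unfolding mild_solution_def sg h_def[symmetric]
        by (rule mild_solution_eq_integral[OF \<phi> h h_dom t])
      then have "mild_solution l s \<phi> f r t \<bullet> \<omega> = \<phi> \<bullet> \<omega> + integral {0..t} (\<lambda>\<rho>. mild_velocity \<phi> h \<rho> \<bullet> \<omega>)"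
        using integral_linear[OF vel_int bounded_linear_inner_left[of \<omega>]]
        by (simp add: inner_add_left comp_def)
      moreover have "integral {0..t} (V r) = integral {0..t} (\<lambda>\<rho>. mild_velocity \<phi> h \<rho> \<bullet> \<omega>) - (w t - w 0)"
        unfolding V_def h_def[symmetric]
        using integral_unique[OF w_int] integrable_linear[OF vel_int bounded_linear_inner_left[of \<omega>]]
          has_integral_integrable[OF w_int]
        by (simp add: Henstock_Kurzweil_Integration.integral_diff comp_def)
      ultimately show ?thesis using assms(10) by simp
    qed
  qed
  have V_0: "V r t = 0 \<longleftrightarrow> r t = g t + integral {0..t} (\<lambda>\<tau>. K t \<tau> * r \<tau>)"
    if "continuous_on {0..T} r" "t \<in> {0..T}" for r t
    using V_eq[OF that] nz[OF that(2)] by auto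
  \<comment> \<open>Agreement with \<open>w\<close> at every time makes the integral of
    \<open>V r\<close> over each [0,t] vanish, which forces the continuous \<open>V r\<close> itself
    to vanish.\<close>
  have "solves_volterra T g K r"
    if r: "continuous_on {0..T} r" and obs: "\<forall>t\<in>{0..T}. mild_solution l s \<phi> f r t \<bullet> \<omega> = w t" for r
  proof -
    have "integral {0..t} (V r) = 0" if "t \<in> {0..T}" for t
      using V_int[OF r that] obs that by simp
    then have "V r t = 0" if "t \<in> {0..T}" for t
      using eq_0_if_integral_eq_0[OF \<open>0 < T\<close> V_cont[OF r that]] that by blast
    then show ?thesis using V_0[OF r] by (simp add: solves_volterra_def)
  qed
  moreover have "mild_solution l s \<phi> f r t \<bullet> \<omega> = w t"
    if r: "continuous_on {0..T} r" and "solves_volterra T g K r" and t: "t \<in> {0..T}" for r t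
  proof -
    have "V r \<rho> = 0" if "\<rho> \<in> {0..t}" for \<rho>
      using V_0[OF r] \<open>solves_volterra T g K r\<close> that t by (simp add: solves_volterra_def)
    then have "integral {0..t} (V r) = integral {0..t} (\<lambda>\<rho>. 0)" by (rule integral_cong)
    then show ?thesis using V_int[OF r t] by simp
  qed
  moreover note volterra_unique_solution[OF less_imp_le[OF \<open>0 < T\<close>] cont_g cont_K]
  ultimately show ?thesis
    unfolding Let_def g_def[symmetric] K_def[symmetric] by blast
qed

end
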